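(* Assume $\diamondsuit$. Then there exists a Valdivia compact space $K$ such that: (a) $w(K)=\omega_1$; (b) $K$ has the countable chain condition (ccc); (c) $K$ has no $G_\delta$ points; (d) $K$ does not have a nontrivial convergent sequence in the complement of a dense $\Sigma$-subset; that is, for every dense $\Sigma$-subset $S$ of $K$, the subspace $K\setminus S$ has no nontrivial convergent sequence.
   Context: For an index set $\Gamma$, $\Sigma(\Gamma)$ is the set of $x\in\mathbb{R}^\Gamma$ such that $\{\gamma\in\Gamma:x_\gamma\ne0\}$ is countable; $\mathbb{R}^\Gamma$ has the product topology. A $\Sigma$-subset of a compact Hausdorff space $K$ is a subset of the form $\varphi^{-1}[\Sigma(\Gamma)]$, where $\Gamma$ is some index set and $\varphi:K\to\mathbb{R}^\Gamma$ is a continuous injection. $K$ is a Valdivia compact space if it is compact Hausdorff and admits a dense $\Sigma$-subset. $w(K)$ is the weight of $K$. A topological space has ccc if every family of pairwise disjoint nonempty open subsets is countable. A $G_\delta$ point of $K$ is a point $x$ such that $\{x\}$ is a $G_\delta$ subset of $K$. A nontrivial convergent sequence in $K\setminus S$ is a sequence of points of $K\setminus S$ that is not eventually constant and converges to a point of $K\setminus S$. $\diamondsuit$ is the combinatorial principle: there exists a family $(D_\alpha)_{\alpha\in\omega_1}$ with $D_\alpha\subset\alpha$ for all $\alpha$, such that for every $X\subset\omega_1$ the set $\{\alpha\in\omega_1:X\cap\alpha=D_\alpha\}$ is stationary in $\omega_1$. *)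

theory Defs
  imports "HOL-Analysis.Analysis"
begin

unbundle cardinal_syntax

section \<open>The ordinal \<open>\<omega>\<^sub>1\<close> as a type\<close>

text \<open>
  The library type \<open>'a suc\<close> carries the well-order \<open>card_suc\<close>, the initial ordinal of the
  cardinal successor of \<open>'a\<close> (the argument of \<open>card_suc\<close> is ignored). For \<open>'a = nat\<close> it is
  \<open>\<omega>\<^sub>1\<close>, so that \<open>{..<\<alpha>}\<close> is the ordinal \<open>\<alpha>\<close> regarded as the set of its predecessors.
\<close>

instantiation suc :: (type) wellorder
begin

definition less_eq_suc :: "'a suc \<Rightarrow> 'a suc \<Rightarrow> bool" where
  "(x :: 'a suc) \<le> y \<longleftrightarrow> (x, y) \<in> card_suc |UNIV :: 'a set|"

definition less_suc :: "'a suc \<Rightarrow> 'a suc \<Rightarrow> bool" where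
  "(x :: 'a suc) < y \<longleftrightarrow> x \<le> y \<and> x \<noteq> y"

instance
proof -
  have "card_order (card_suc |UNIV :: 'a set| )"
    by (intro card_order_card_suc card_of_card_order_on)
  then have "well_order (card_suc |UNIV :: 'a set| )"
    by (simp add: card_order_on_def)
  then have lin: "linear_order (card_suc |UNIV :: 'a set| )"
    and wf: "wf (card_suc |UNIV :: 'a set| - Id)"
    by (simp_all add: well_order_on_def)
  have refl: "x \<le> x" for x :: "'a suc"
    using lin by (auto simp: order_on_defs less_eq_suc_def dest: refl_onD)
  have trans: "x \<le> z" if "x \<le> y" "y \<le> z" for x y z :: "'a suc"
    using lin that by (auto simp: order_on_defs less_eq_suc_def dest: transD)
  have antisym: "x = y" if "x \<le> y" "y \<le> x" for x y :: "'a suc"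
    using lin that by (auto simp: order_on_defs less_eq_suc_def dest: antisymD)
  have total: "x \<le> y \<or> y \<le> x" for x y :: "'a suc"
  proof (cases "x = y")
    case False
    then show ?thesis
      using lin by (auto simp: order_on_defs less_eq_suc_def total_on_def)
  qed (use refl in simp)
  have less: "{(x, y). x < y} = card_suc |UNIV :: 'a set| - Id"
    by (auto simp: less_suc_def less_eq_suc_def)
  show "OFCLASS('a suc, wellorder_class)"
  proof
    fix P :: "'a suc \<Rightarrow> bool" and a
    assume "\<And>x. (\<And>y. y < x \<Longrightarrow> P y) \<Longrightarrow> P x"
    with wf show "P a"
      unfolding less[symmetric] by (induction a rule: wf_induct_rule) auto
  qed (use refl trans antisym total in \<open>auto simp: less_suc_def\<close>)
qed

end

type_synonym omega1 = "nat suc"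


section \<open>The diamond principle\<close>

text \<open>The hypothesis on \<open>\<delta>\<close> in the second conjunct says that \<open>\<delta>\<close> is a limit ordinal (in
  particular nonzero) and a supremum of elements of \<open>C\<close> below it.\<close>

definition club :: "omega1 set \<Rightarrow> bool" where
  "club C \<longleftrightarrow>
     (\<forall>\<alpha>. \<exists>\<beta>\<in>C. \<alpha> < \<beta>) \<and>
     (\<forall>\<delta>. (\<exists>\<beta>. \<beta> < \<delta>) \<and> (\<forall>\<beta><\<delta>. \<exists>\<gamma>\<in>C. \<beta> < \<gamma> \<and> \<gamma> < \<delta>) \<longrightarrow> \<delta> \<in> C)"

definition stationary :: "omega1 set \<Rightarrow> bool" where
  "stationary A \<longleftrightarrow> (\<forall>C. club C \<longrightarrow> A \<inter> C \<noteq> {})"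

definition diamond :: bool where
  "diamond \<longleftrightarrow>
     (\<exists>D :: omega1 \<Rightarrow> omega1 set.
        (\<forall>\<alpha>. D \<alpha> \<subseteq> {..<\<alpha>}) \<and> (\<forall>X. stationary {\<alpha>. X \<inter> {..<\<alpha>} = D \<alpha>}))"


section \<open>Weight, the countable chain condition, convergent sequences\<close>

definition is_base :: "'a topology \<Rightarrow> 'a set set \<Rightarrow> bool" where
  "is_base X \<B> \<longleftrightarrow>
     (\<forall>V\<in>\<B>. openin X V) \<and> (\<forall>U x. openin X U \<and> x \<in> U \<longrightarrow> (\<exists>V\<in>\<B>. x \<in> V \<and> V \<subseteq> U))"

text \<open>The least cardinality of a base, a cardinal being represented as in the library by a
  well-order relation; it is determined up to \<open>=o\<close>.\<close>

definition weight :: "'a topology \<Rightarrow> 'a set rel" where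
  "weight X = |SOME \<B>. is_base X \<B> \<and> (\<forall>\<B>'. is_base X \<B>' \<longrightarrow> |\<B>| \<le>o |\<B>'| )|"

lemma weight_minimal:
  obtains \<B> where "is_base X \<B>" "weight X = |\<B>|"
    "\<And>\<B>'. is_base X \<B>' \<Longrightarrow> |\<B>| \<le>o |\<B>'|"
proof -
  have "is_base X {U. openin X U}"
    unfolding is_base_def by auto
  then have "card_of ` {\<B>. is_base X \<B>} \<noteq> {}"
    by auto
  moreover have "\<forall>r \<in> card_of ` {\<B>. is_base X \<B>}. Well_order r"
    by (auto intro: card_of_Well_order)
  ultimately have "\<exists>r \<in> card_of ` {\<B>. is_base X \<B>}. \<forall>r' \<in> card_of ` {\<B>. is_base X \<B>}. r \<le>o r'"
    by (rule exists_minim_Well_order)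
  then have "\<exists>\<B>. is_base X \<B> \<and> (\<forall>\<B>'. is_base X \<B>' \<longrightarrow> |\<B>| \<le>o |\<B>'| )"
    by simp
  note * = someI_ex[OF this]
  show ?thesis
    by (rule that[OF conjunct1[OF *] weight_def mp[OF spec[OF conjunct2[OF *]]]])
qed

definition ccc_space :: "'a topology \<Rightarrow> bool" where
  "ccc_space X \<longleftrightarrow>
     (\<forall>\<U>. (\<forall>U\<in>\<U>. openin X U \<and> U \<noteq> {}) \<and> pairwise disjnt \<U> \<longrightarrow> countable \<U>)"

definition has_nontrivial_convergent_sequence :: "'a topology \<Rightarrow> bool" where
  "has_nontrivial_convergent_sequence X \<longleftrightarrow>
     (\<exists>(s :: nat \<Rightarrow> 'a) l. range s \<subseteq> topspace X \<and>
        \<not> (\<exists>c. \<forall>\<^sub>F n in sequentially. s n = c) \<and> limitin X s l sequentially)"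


section \<open>Sigma-subsets and Valdivia compact spaces\<close>

definition Sigma_product :: "'i set \<Rightarrow> ('i \<Rightarrow> real) set" where
  "Sigma_product \<Gamma> = {x \<in> \<Gamma> \<rightarrow>\<^sub>E UNIV. countable {\<gamma>\<in>\<Gamma>. x \<gamma> \<noteq> 0}}"

text \<open>
  HOL cannot quantify over the type of the index set inside a definition. Index sets of type
  \<open>('a \<Rightarrow> real) set\<close> suffice for spaces on the type \<open>'a\<close>: the lemma \<open>sigma_subsetI\<close> below shows
  that every index set of every type gives a \<open>sigma_subset\<close> in this sense.
\<close>

definition sigma_subset :: "'a topology \<Rightarrow> 'a set \<Rightarrow> bool" where
  "sigma_subset K S \<longleftrightarrow>
     (\<exists>(\<Gamma> :: ('a \<Rightarrow> real) set) \<phi>.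
        continuous_map K (product_topology (\<lambda>_. euclideanreal) \<Gamma>) \<phi> \<and>
        inj_on \<phi> (topspace K) \<and>
        S = {x \<in> topspace K. \<phi> x \<in> Sigma_product \<Gamma>})"

definition dense_sigma_subset :: "'a topology \<Rightarrow> 'a set \<Rightarrow> bool" where
  "dense_sigma_subset K S \<longleftrightarrow> sigma_subset K S \<and> K closure_of S = topspace K"

text \<open>
  A compact Hausdorff space of weight at most \<open>\<omega>\<^sub>1\<close> embeds into the \<open>\<omega>\<^sub>1\<close>-fold power of the real
  line, so up to homeomorphism the topologies on the type \<open>omega1 \<Rightarrow> real\<close> (with arbitrary
  carriers) include all such spaces.
\<close>

definition Valdivia_compact :: "'a topology \<Rightarrow> bool" where
  "Valdivia_compact K \<longleftrightarrow>
     compact_space K \<and> Hausdorff_space K \<and> (\<exists>S. dense_sigma_subset K S)"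

text \<open>
  Coordinates of \<open>\<phi>\<close> that agree as functions are merged: into a single coordinate if there are
  countably many of them, and into continuum many copies otherwise. This does not change which
  points of \<open>K\<close> have countable support.
\<close>

lemma sigma_subsetI:
  fixes K :: "'a topology" and \<Gamma> :: "'i set"
  assumes cont: "continuous_map K (product_topology (\<lambda>_. euclideanreal) \<Gamma>) \<phi>"
    and inj: "inj_on \<phi> (topspace K)"
  shows "sigma_subset K {x \<in> topspace K. \<phi> x \<in> Sigma_product \<Gamma>}"
proof -
  have "(UNIV :: nat set set) \<lesssim> (UNIV :: real set)"
    using nat_sets_eqpoll_reals eqpoll_imp_lepoll by blast
  have "(UNIV :: real set) \<lesssim> (UNIV :: nat set set)"
    using nat_sets_eqpoll_reals eqpoll_imp_lepoll eqpoll_sym by blast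
  then obtain a :: "real \<Rightarrow> nat set" where a: "inj a"
    by (auto simp: lepoll_def)
  from \<open>(UNIV :: nat set set) \<lesssim> UNIV\<close> obtain b :: "nat set \<Rightarrow> real" where b: "inj b"
    by (auto simp: lepoll_def)
  define pr where "pr u v = b ((\<lambda>n. 2 * n) ` a u \<union> (\<lambda>n. 2 * n + 1) ` a v)" for u v
  have pr: "u = u' \<and> v = v'" if "pr u v = pr u' v'" for u v u' v'
  proof -
    have eq: "(\<lambda>n. 2 * n) ` a u \<union> (\<lambda>n. 2 * n + 1) ` a v =
        (\<lambda>n. 2 * n) ` a u' \<union> (\<lambda>n. 2 * n + 1) ` a v'"
      using that unfolding pr_def by (rule injD[OF b])
    have "n \<in> a u \<longleftrightarrow> n \<in> a u'" for n
      using arg_cong[OF eq, of "\<lambda>A. 2 * n \<in> A"] by (auto simp: image_iff; presburger)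
    moreover have "n \<in> a v \<longleftrightarrow> n \<in> a v'" for n
      using arg_cong[OF eq, of "\<lambda>A. 2 * n + 1 \<in> A"] by (auto simp: image_iff; presburger)
    ultimately show ?thesis
      using a by (meson injD set_eqI)
  qed
  define h :: "('a \<Rightarrow> real) \<times> real \<Rightarrow> 'a \<Rightarrow> real" where "h p = (\<lambda>x. pr (fst p x) (snd p))" for p
  have "inj h"
  proof (rule injI)
    fix p q assume "h p = h q"
    then have "pr (fst p x) (snd p) = pr (fst q x) (snd q)" for x
      unfolding h_def by (rule fun_cong)
    from pr[OF this] show "p = q"
      by (auto simp: prod_eq_iff)
  qed
  define g where "g \<gamma> = (\<lambda>x. \<phi> x \<gamma>)" for \<gamma>
  define fib where "fib f = {\<gamma>\<in>\<Gamma>. g \<gamma> = f}" for f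
  define P :: "(('a \<Rightarrow> real) \<times> real) set"
    where "P = {(f, r). f \<in> g ` \<Gamma> \<and> (r = 0 \<or> uncountable (fib f))}"
  define \<psi> where "\<psi> x = restrict (\<lambda>k. fst (inv h k) x) (h ` P)" for x
  have psi: "\<psi> x (h p) = fst p x" if "p \<in> P" for x p
    using that \<open>inj h\<close> by (simp add: \<psi>_def)
  have cg: "continuous_map K euclideanreal (g \<gamma>)" if "\<gamma> \<in> \<Gamma>" for \<gamma>
    using cont that unfolding continuous_map_componentwise g_def by auto
  have ext: "\<phi> x \<in> extensional \<Gamma>" if "x \<in> topspace K" for x
    using cont that unfolding continuous_map_componentwise by auto
  have "continuous_map K (product_topology (\<lambda>_. euclideanreal) (h ` P)) \<psi>"
    unfolding continuous_map_componentwise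
  proof (intro conjI ballI)
    show "\<psi> ` topspace K \<subseteq> extensional (h ` P)"
      by (auto simp: \<psi>_def)
    fix k assume "k \<in> h ` P"
    then obtain p where p: "p \<in> P" "k = h p" by auto
    then obtain \<gamma> where "\<gamma> \<in> \<Gamma>" "fst p = g \<gamma>" by (auto simp: P_def)
    with cg p psi show "continuous_map K euclideanreal (\<lambda>x. \<psi> x k)"
      by (metis (no_types, lifting) continuous_map_eq)
  qed
  moreover have "inj_on \<psi> (topspace K)"
  proof
    fix x y assume xy: "x \<in> topspace K" "y \<in> topspace K" "\<psi> x = \<psi> y"
    have "\<phi> x \<gamma> = \<phi> y \<gamma>" if "\<gamma> \<in> \<Gamma>" for \<gamma>
    proof -
      have "(g \<gamma>, 0) \<in> P" using that by (auto simp: P_def)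
      with xy psi[of "(g \<gamma>, 0)"] show ?thesis by (metis fst_conv g_def)
    qed
    then have "\<phi> x = \<phi> y"
      using ext xy by (intro extensionalityI[of _ \<Gamma>]) auto
    with inj xy show "x = y" by (auto dest: inj_onD)
  qed
  moreover have "\<phi> x \<in> Sigma_product \<Gamma> \<longleftrightarrow> \<psi> x \<in> Sigma_product (h ` P)" if x: "x \<in> topspace K" for x
  proof -
    let ?F = "{f \<in> g ` \<Gamma>. f x \<noteq> 0}"
    let ?Q = "{p \<in> P. fst p x \<noteq> 0}"
    have "{k \<in> h ` P. \<psi> x k \<noteq> 0} = h ` ?Q"
      using psi by auto
    then have "countable {k \<in> h ` P. \<psi> x k \<noteq> 0} \<longleftrightarrow> countable ?Q"
      using countable_image_inj_eq[OF inj_on_subset[OF \<open>inj h\<close> subset_UNIV]] by simp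
    also have "\<dots> \<longleftrightarrow> countable {\<gamma>\<in>\<Gamma>. \<phi> x \<gamma> \<noteq> 0}"
    proof
      assume Q: "countable ?Q"
      have "?F \<subseteq> fst ` ?Q"
      proof
        fix f assume "f \<in> ?F"
        then have "(f, 0) \<in> ?Q" by (simp add: P_def)
        then show "f \<in> fst ` ?Q" by (rule image_eqI[rotated]) simp
      qed
      then have F: "countable ?F" using countable_image[OF Q] by (rule countable_subset)
      have "countable (fib f)" if "f \<in> ?F" for f
      proof (rule ccontr)
        assume "uncountable (fib f)"
        with that have "Pair f ` UNIV \<subseteq> ?Q" by (auto simp: P_def)
        with Q have "countable (Pair f ` (UNIV :: real set))" by (rule countable_subset[rotated])
        then show False
          using uncountable_UNIV_real by (simp add: countable_image_inj_eq inj_on_def)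
      qed
      then have "countable (\<Union>f\<in>?F. fib f)" using F by blast
      moreover have "{\<gamma>\<in>\<Gamma>. \<phi> x \<gamma> \<noteq> 0} \<subseteq> (\<Union>f\<in>?F. fib f)"
        by (auto simp: fib_def g_def)
      ultimately show "countable {\<gamma>\<in>\<Gamma>. \<phi> x \<gamma> \<noteq> 0}" by (rule countable_subset[rotated])
    next
      assume G: "countable {\<gamma>\<in>\<Gamma>. \<phi> x \<gamma> \<noteq> 0}"
      have "?F \<subseteq> g ` {\<gamma>\<in>\<Gamma>. \<phi> x \<gamma> \<noteq> 0}" by (auto simp: g_def)
      then have F: "countable ?F" using countable_image[OF G] by (rule countable_subset)
      have "countable (fib f)" if "f \<in> ?F" for f
      proof (rule countable_subset[OF _ G])
        show "fib f \<subseteq> {\<gamma>\<in>\<Gamma>. \<phi> x \<gamma> \<noteq> 0}"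
        proof
          fix \<gamma> assume "\<gamma> \<in> fib f"
          then have "\<gamma> \<in> \<Gamma>" "g \<gamma> x = f x" by (auto simp: fib_def)
          with that show "\<gamma> \<in> {\<gamma>\<in>\<Gamma>. \<phi> x \<gamma> \<noteq> 0}" by (simp add: g_def)
        qed
      qed
      then have "?Q \<subseteq> ?F \<times> {0}" by (auto simp: P_def)
      moreover have "countable (?F \<times> {0::real})" using F by (intro countable_SIGMA) auto
      ultimately show "countable ?Q" by (rule countable_subset)
    qed
    finally show ?thesis
      using ext[OF x] by (auto simp: Sigma_product_def PiE_def \<psi>_def)
  qed
  ultimately show ?thesis
    unfolding sigma_subset_def by (intro exI[of _ "h ` P"] exI[of _ \<psi>]) auto
qed

end

theory Submission
  imports Defs "HOL-Probability.Infinite_Product_Measure" "HOL-Library.Countable_Set_Type"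
begin

text \<open>The points of the space \<open>K\<close> are subsets \<open>x\<close> of \<open>\<omega>\<^sub>1\<close>, identified with their characteristic
  functions. For every \<open>\<beta>\<close> a closed set \<open>F \<beta>\<close> is chosen, membership in which depends on
  \<open>x \<inter> \<beta>\<close> only, and \<open>x\<close> belongs to \<open>K\<close> iff \<open>x \<in> F \<beta>\<close> for every \<open>\<beta> \<in> x\<close>: the set \<open>F \<beta>\<close>
  says which points below \<open>\<beta>\<close> may be continued by the element \<open>\<beta>\<close>. The space \<open>K\<close> is compact,
  and a point cut off at \<open>\<alpha>\<close> is again a point, so the countable points form a dense Sigma-subset.
  The sets \<open>F \<beta>\<close> are chosen by transfinite recursion, and three demands are made on them.

  \<^item> Every countable point lies in \<open>F \<beta>\<close> for arbitrarily large \<open>\<beta>\<close>. Countably many open sets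
    control only the coordinates below some \<open>\<alpha>\<close>. If they isolated a point, that point would be
    its own trace on \<open>\<alpha>\<close>, hence countable, and adding a suitable \<open>\<beta> \<ge> \<alpha>\<close> would give a second
    point with the same trace. So there are no \<open>G\<^sub>\<delta>\<close> points.

  \<^item> Let a random point of \<open>K\<close> be built by tossing a fair coin at each \<open>\<beta>\<close> that the part
    constructed so far allows as a continuation. Among the points below \<open>\<beta>\<close>, every nonempty
    relatively open subset of \<open>F \<beta>\<close> is to be hit by the random point with positive probability. Then every nonempty open
    subset of \<open>K\<close> has positive probability, and \<open>K\<close> is ccc (\<open>ccc_cantor_points\<close>).

  \<^item> By \<open>\<diamondsuit>\<close> the continuum hypothesis holds, so there is a list of length \<open>\<omega>\<^sub>1\<close> of all sequences
    of traces \<open>z\<^sub>n \<subseteq> \<alpha>\<close>. At stage \<open>\<beta>\<close> a single point \<open>w\<close> is selected for \<open>F \<beta>\<close>, and \<open>F \<beta>\<close>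
    contains no point whose trace is a term \<open>z\<^sub>n\<close> of a sequence listed up to \<open>\<beta>\<close>, unless
    \<open>z\<^sub>n\<close> is the trace of \<open>w\<close>.

  The third demand shows that a sequence of points \<open>y\<^sub>n \<noteq> x\<close> cannot converge to an uncountable
  point \<open>x\<close>. Choose \<open>\<alpha>\<close> below which all \<open>y\<^sub>n\<close> differ from \<open>x\<close>, and \<open>\<beta> \<in> x\<close> beyond the stage
  at which the traces of \<open>x\<close> and of the \<open>y\<^sub>n\<close> on \<open>\<alpha>\<close> are listed. As \<open>x \<in> F \<beta>\<close>, the trace of
  \<open>x\<close> is that of \<open>w\<close>; so no \<open>y\<^sub>n\<close> is in \<open>F \<beta>\<close>, and \<open>\<beta>\<close> belongs to \<open>x\<close> but to no \<open>y\<^sub>n\<close>.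

  The demands are compatible because \<open>F \<beta>\<close> can be thin without being null (\<open>exists_supported\<close>).
  The countably many forbidden traces are null events not containing \<open>w\<close>. They are covered by
  cylinders whose total probability is small compared with that of each neighbourhood of \<open>w\<close>, and
  the complement, freed of its null cylinders, still accumulates at \<open>w\<close>. That traces are null is
  arranged by leaving countably many coordinates unrestricted.

  Finally, an arbitrary dense Sigma-subset \<open>S\<close> contains the set \<open>S\<^sub>0\<close> of countable points. A point of
  \<open>S\<close> is not isolated, and as Sigma-subsets have the Frechet-Urysohn property it is the limit of a
  sequence of other points of \<open>S\<close>; hence it is countable. So \<open>S\<close> is a dense subset of \<open>S\<^sub>0\<close>, every
  point of \<open>S\<^sub>0\<close> is the limit of a sequence in \<open>S\<close>, and \<open>S\<close> is closed under such limits. A sequence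
  in the complement of \<open>S\<close> therefore has an uncountable limit and is eventually constant.\<close>

section \<open>The first uncountable ordinal\<close>

lemma countable_lessThan_omega1: "countable {..<(\<alpha> :: omega1)}"
proof -
  let ?r = "card_suc |UNIV :: nat set|"
  have o: "card_order |UNIV :: nat set|" by (rule card_of_card_order_on)
  have "Card_order ?r" by (rule Card_order_card_suc[OF o])
  moreover have "\<alpha> \<in> Field ?r" by (simp add: Field_card_suc)
  ultimately have "|underS ?r \<alpha>| <o ?r" by (rule card_of_underS)
  moreover have "underS ?r \<alpha> = {..<\<alpha>}"
    by (auto simp: underS_def less_suc_def less_eq_suc_def)
  ultimately have "|{..<\<alpha>}| <o ?r" by simp
  then have "|{..<\<alpha>}| \<le>o |UNIV :: nat set|"
    by (intro card_suc_ordLess_imp_ordLeq[OF _ _ o]) (simp_all add: card_of_Card_order)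
  then show ?thesis by (simp add: countable_card_of_nat)
qed

lemma card_omega1: "|UNIV :: omega1 set| =o card_suc natLeq"
proof -
  have "card_order (card_suc natLeq)"
    by (rule card_order_card_suc[OF natLeq_card_order])
  then show ?thesis
    using card_of_unique ordIso_symmetric Field_card_suc by metis
qed

lemma uncountable_omega1: "uncountable (UNIV :: omega1 set)"
proof
  assume "countable (UNIV :: omega1 set)"
  then have "|UNIV :: omega1 set| \<le>o natLeq"
    by (simp add: countable_card_le_natLeq)
  moreover have "natLeq <o |UNIV :: omega1 set|"
    using card_suc_greater[OF natLeq_card_order] card_omega1 ordIso_symmetric ordLess_ordIso_trans
    by blast
  ultimately show False using not_ordLess_ordLeq by blast
qed

lemma countable_atMost_omega1: "countable {..(\<alpha> :: omega1)}"
proof -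
  have "{..\<alpha>} = insert \<alpha> {..<\<alpha>}" by auto
  then show ?thesis using countable_lessThan_omega1[of \<alpha>] by simp
qed

lemma countable_bounded_omega1:
  assumes "countable (C :: omega1 set)"
  obtains \<alpha> where "C \<subseteq> {..<\<alpha>}"
proof -
  have "countable (\<Union>c\<in>C. {..c})"
    using assms countable_atMost_omega1 by blast
  then obtain \<alpha> where "\<alpha> \<notin> (\<Union>c\<in>C. {..c})"
    using uncountable_omega1 by (metis UNIV_eq_I)
  then have "c < \<alpha>" if "c \<in> C" for c
    using that by force
  then show ?thesis by (intro that[of \<alpha>]) auto
qed

lemma ex_greater_omega1: "\<exists>\<beta>. (\<alpha> :: omega1) < \<beta>"
  using countable_bounded_omega1[of "{\<alpha>}"] by auto

lemma uncountable_unbounded_omega1: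
  assumes "uncountable (C :: omega1 set)"
  obtains \<beta> where "\<beta> \<in> C" "\<alpha> \<le> \<beta>"
  using assms countable_subset[OF _ countable_lessThan_omega1[of \<alpha>], of C] by fastforce

lemma ex_separating_omega1:
  assumes "\<And>n :: nat. x \<noteq> (y n :: omega1 set)"
  obtains \<alpha> where "\<alpha>0 \<le> \<alpha>" "\<And>n. x \<inter> {..<\<alpha>} \<noteq> y n \<inter> {..<\<alpha>}"
proof -
  have "\<exists>\<xi>. \<xi> \<in> x \<longleftrightarrow> \<xi> \<notin> y n" for n
    using assms[of n] by auto
  then obtain \<xi> where \<xi>: "\<And>n. \<xi> n \<in> x \<longleftrightarrow> \<xi> n \<notin> y n"
    by metis
  obtain \<alpha> where "insert \<alpha>0 (range \<xi>) \<subseteq> {..<\<alpha>}"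
    by (rule countable_bounded_omega1[of "insert \<alpha>0 (range \<xi>)"]) auto
  then show ?thesis
    using \<xi> by (intro that[of \<alpha>]) auto
qed

section \<open>Diamond implies the continuum hypothesis\<close>

text \<open>Take a countably infinite subset of \<open>\<omega>\<^sub>1\<close> as a copy of \<open>nat\<close>. Every subset of it equals its trace on every
  \<open>\<alpha>\<close> above the copy. These \<open>\<alpha>\<close> form a club set, so one of them guesses the subset, and a guess
  belongs to one subset only.\<close>

lemma diamond_imp_lepoll:
  assumes diamond
  shows "(UNIV :: nat set set) \<lesssim> (UNIV :: omega1 set)"
proof -
  obtain D :: "omega1 \<Rightarrow> omega1 set"
    where D: "\<And>X. stationary {\<alpha>. X \<inter> {..<\<alpha>} = D \<alpha>}"
    using assms unfolding diamond_def by blast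
  have "infinite (UNIV :: omega1 set)"
    using uncountable_omega1 countable_finite by blast
  then obtain e :: "nat \<Rightarrow> omega1" where e: "inj e"
    by (metis infinite_countable_subset)
  obtain \<alpha>0 where \<alpha>0: "range e \<subseteq> {..<\<alpha>0}"
    by (rule countable_bounded_omega1[of "range e"]) auto
  have "club {\<alpha>0<..}"
    unfolding club_def
  proof (intro conjI allI impI)
    show "\<exists>\<beta>\<in>{\<alpha>0<..}. \<alpha> < \<beta>" for \<alpha>
      using ex_greater_omega1[of "max \<alpha> \<alpha>0"] by auto
    show "\<delta> \<in> {\<alpha>0<..}"
      if "(\<exists>\<beta>. \<beta> < \<delta>) \<and> (\<forall>\<beta><\<delta>. \<exists>\<gamma>\<in>{\<alpha>0<..}. \<beta> < \<gamma> \<and> \<gamma> < \<delta>)" for \<delta>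
      using that by force
  qed
  then have "\<exists>\<alpha>. \<alpha>0 < \<alpha> \<and> e ` X \<inter> {..<\<alpha>} = D \<alpha>" for X
    using D[of "e ` X"] unfolding stationary_def by fastforce
  then obtain a where a: "\<And>X. \<alpha>0 < a X \<and> e ` X \<inter> {..<a X} = D (a X)"
    by metis
  have "e ` X = D (a X)" for X
  proof -
    have "e ` X \<subseteq> {..<a X}"
      using a[of X] \<alpha>0 by (auto dest: less_trans)
    with a[of X] show ?thesis by blast
  qed
  then have "inj a"
    using e by (metis injI inj_image_eq_iff)
  then show ?thesis by (auto simp: lepoll_def)
qed

lemma omega1_times_omega1: "(UNIV :: (omega1 \<times> omega1) set) \<lesssim> (UNIV :: omega1 set)"
proof -
  have "infinite (UNIV :: omega1 set)"
    using uncountable_omega1 countable_finite by blast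
  then have "|(UNIV :: omega1 set) \<times> (UNIV :: omega1 set)| =o |UNIV :: omega1 set|"
    by (rule card_of_Times_same_infinite)
  then show ?thesis
    using card_of_ordLeq[of "UNIV :: (omega1 \<times> omega1) set" "UNIV :: omega1 set"]
      ordIso_imp_ordLeq by (fastforce simp: lepoll_def)
qed

text \<open>The list of sequences of traces, which by the continuum hypothesis has length \<open>\<omega>\<^sub>1\<close>. Every sequence
  must occur arbitrarily late because the terms \<open>z 0\<close> also serve to list the countable points, each of
  which has to be selected cofinally often.\<close>

lemma diamond_enumeration:
  assumes diamond
  obtains E :: "omega1 \<Rightarrow> omega1 \<times> (nat \<Rightarrow> omega1 set)"
  where "\<And>\<alpha> z \<xi>. (\<And>n. z n \<subseteq> {..<\<alpha>}) \<Longrightarrow> \<exists>\<beta>\<ge>\<xi>. E \<beta> = (\<alpha>, z)"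
proof -
  obtain c :: "nat set \<Rightarrow> omega1" where c: "inj c"
    using diamond_imp_lepoll[OF assms] by (auto simp: lepoll_def)
  obtain p :: "omega1 \<times> omega1 \<Rightarrow> omega1" where p: "inj p"
    using omega1_times_omega1 by (auto simp: lepoll_def)
  define code :: "omega1 \<Rightarrow> (nat \<Rightarrow> omega1 set) \<Rightarrow> nat set"
    where "code \<alpha> z = {prod_encode (n, to_nat_on {..<\<alpha>} \<gamma>) | n \<gamma>. \<gamma> \<in> z n}" for \<alpha> z
  have code: "z = z'"
    if eq: "code \<alpha> z = code \<alpha> z'" and z: "\<And>n. z n \<subseteq> {..<\<alpha>}" "\<And>n. z' n \<subseteq> {..<\<alpha>}" for \<alpha> z z'
  proof -
    have *: "\<gamma> \<in> y n \<longleftrightarrow> prod_encode (n, to_nat_on {..<\<alpha>} \<gamma>) \<in> code \<alpha> y"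
      if "\<gamma> < \<alpha>" "\<And>n. y n \<subseteq> {..<\<alpha>}" for \<gamma> n y
      using that(1) subsetD[OF that(2)] countable_lessThan_omega1[of \<alpha>]
      by (auto simp: code_def dest!: inj_prod_encode[THEN injD])
    have "\<gamma> \<in> z n \<longleftrightarrow> \<gamma> \<in> z' n" for \<gamma> n
      using *[of \<gamma> z n] *[of \<gamma> z' n] eq z by blast
    then show ?thesis by blast
  qed
  \<comment> \<open>The last component of a triple only multiplies the occurrences of a sequence.\<close>
  define h where "h t = p (p (fst (fst t), c (code (fst (fst t)) (snd (fst t)))), snd t)" for t
  define Q :: "((omega1 \<times> (nat \<Rightarrow> omega1 set)) \<times> omega1) set"
    where "Q = {t. \<forall>n. snd (fst t) n \<subseteq> {..<fst (fst t)}}"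
  have "inj_on h Q"
  proof
    fix s t assume st: "s \<in> Q" "t \<in> Q" "h s = h t"
    from st(3) have "fst (fst s) = fst (fst t)" "snd s = snd t"
      "code (fst (fst s)) (snd (fst s)) = code (fst (fst t)) (snd (fst t))"
      unfolding h_def inj_eq[OF p] inj_eq[OF c] prod.inject by blast+
    moreover from this have "snd (fst s) = snd (fst t)"
      using st(1,2) by (intro code[of "fst (fst t)"]) (auto simp: Q_def)
    ultimately show "s = t"
      by (simp add: prod_eq_iff)
  qed
  define E where "E \<beta> = fst (inv_into Q h \<beta>)" for \<beta>
  show ?thesis
  proof
    fix \<alpha> \<xi> :: omega1 and z :: "nat \<Rightarrow> omega1 set"
    assume z: "\<And>n. z n \<subseteq> {..<\<alpha>}"
    define T where "T = range (\<lambda>\<eta>. h ((\<alpha>, z), \<eta>))"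
    have Q: "((\<alpha>, z), \<eta>) \<in> Q" for \<eta>
      using z by (simp add: Q_def)
    have "inj (\<lambda>\<eta>. h ((\<alpha>, z), \<eta>))"
      using \<open>inj_on h Q\<close> Q by (auto intro!: injI dest: inj_onD)
    then have "uncountable T"
      unfolding T_def using uncountable_omega1 by (simp add: countable_image_inj_eq)
    then obtain \<beta> where "\<beta> \<in> T" "\<xi> \<le> \<beta>"
      by (rule uncountable_unbounded_omega1)
    moreover have "E \<beta> = (\<alpha>, z)"
      using \<open>\<beta> \<in> T\<close> Q \<open>inj_on h Q\<close> by (auto simp: T_def E_def)
    ultimately show "\<exists>\<beta>\<ge>\<xi>. E \<beta> = (\<alpha>, z)" by blast
  qed
qed

section \<open>Systems of closed sets and the random point\<close>

text \<open>Closed sets of points that depend on the coordinates below \<open>\<beta>\<close>, given by forbidden finite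
  conditions: \<open>(A, B)\<close> stands for the cylinder of all \<open>x\<close> with \<open>x \<inter> A = B\<close>. As only countably
  many conditions live below \<open>\<beta>\<close>, that the random point lies in such a set is a measurable event.\<close>

definition closed_below :: "omega1 \<Rightarrow> omega1 set set \<Rightarrow> bool" where
  "closed_below \<beta> R \<longleftrightarrow>
     (\<exists>\<G>. (\<forall>(A, B)\<in>\<G>. finite A \<and> A \<subseteq> {..<\<beta>} \<and> B \<subseteq> A) \<and> R = {x. \<forall>(A, B)\<in>\<G>. x \<inter> A \<noteq> B})"

definition points :: "(omega1 \<Rightarrow> omega1 set set) \<Rightarrow> omega1 set set" where
  "points F = {x. \<forall>\<beta>\<in>x. x \<in> F \<beta>}"

text \<open>With \<open>{}\<close> at the stages from \<open>\<beta>\<close> on, no element \<open>\<ge> \<beta>\<close> can be added: the points of the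
  truncated system are the points of \<open>F\<close> contained in \<open>\<beta>\<close>.\<close>

definition cut_below :: "(omega1 \<Rightarrow> omega1 set set) \<Rightarrow> omega1 \<Rightarrow> omega1 \<Rightarrow> omega1 set set" where
  "cut_below F \<beta> \<gamma> = (if \<gamma> < \<beta> then F \<gamma> else {})"

text \<open>The element \<open>\<beta>\<close> is kept if its coin shows heads and the part of the set kept so far may be
  continued by \<open>\<beta>\<close>. The random point below is the set of all kept elements.\<close>

context
  notes conj_cong [fundef_cong]
begin

function kept :: "(omega1 \<Rightarrow> omega1 set set) \<Rightarrow> (omega1 \<Rightarrow> bool) \<Rightarrow> omega1 \<Rightarrow> bool" where
  "kept F \<epsilon> \<beta> \<longleftrightarrow> \<epsilon> \<beta> \<and> {\<gamma>. \<gamma> < \<beta> \<and> kept F \<epsilon> \<gamma>} \<in> F \<beta>"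
  by auto
termination
proof (relation "inv_image {(\<gamma>, \<beta>). \<gamma> < \<beta>} (\<lambda>(F, \<epsilon>, \<beta>). \<beta>)", goal_cases)
  case 1
  show ?case by (intro wf_inv_image wf)
qed auto

end

declare kept.simps [simp del]

definition random_point :: "(omega1 \<Rightarrow> omega1 set set) \<Rightarrow> (omega1 \<Rightarrow> bool) \<Rightarrow> omega1 set" where
  "random_point F \<epsilon> = {\<beta>. kept F \<epsilon> \<beta>}"

lemma closed_below_UNIV: "closed_below \<beta> UNIV"
  unfolding closed_below_def by (rule exI[of _ "{}"]) auto

lemma closed_below_empty: "closed_below \<beta> {}"
  unfolding closed_below_def by (rule exI[of _ "{({}, {})}"]) auto

lemma closed_below_Int:
  assumes "closed_below \<beta> R" "closed_below \<beta> R'"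
  shows "closed_below \<beta> (R \<inter> R')"
proof -
  obtain \<G> where \<G>: "\<forall>(A, B)\<in>\<G>. finite A \<and> A \<subseteq> {..<\<beta>} \<and> B \<subseteq> A"
    and R: "R = {x. \<forall>(A, B)\<in>\<G>. x \<inter> A \<noteq> B}"
    using assms(1) unfolding closed_below_def by blast
  obtain \<G>' where \<G>': "\<forall>(A, B)\<in>\<G>'. finite A \<and> A \<subseteq> {..<\<beta>} \<and> B \<subseteq> A"
    and R': "R' = {x. \<forall>(A, B)\<in>\<G>'. x \<inter> A \<noteq> B}"
    using assms(2) unfolding closed_below_def by blast
  have "R \<inter> R' = {x. \<forall>(A, B)\<in>\<G> \<union> \<G>'. x \<inter> A \<noteq> B}"
    unfolding R R' ball_Un by (rule Collect_conj_eq[symmetric])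
  with \<G> \<G>' show ?thesis
    unfolding closed_below_def by (intro exI[of _ "\<G> \<union> \<G>'"]) (simp add: ball_Un)
qed

lemma closed_below_cong:
  assumes "closed_below \<beta> R" "x \<inter> {..<\<beta>} = y \<inter> {..<\<beta>}"
  shows "x \<in> R \<longleftrightarrow> y \<in> R"
proof -
  obtain \<G> where \<G>: "\<forall>(A, B)\<in>\<G>. finite A \<and> A \<subseteq> {..<\<beta>} \<and> B \<subseteq> A"
    and R: "R = {x. \<forall>(A, B)\<in>\<G>. x \<inter> A \<noteq> B}"
    using assms(1) unfolding closed_below_def by blast
  have "x \<inter> A = B \<longleftrightarrow> y \<inter> A = B" if "(A, B) \<in> \<G>" for A B
  proof -
    have "A \<subseteq> {..<\<beta>}" using \<G> that by auto
    with assms(2) have "x \<inter> A = y \<inter> A" by blast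
    then show ?thesis by simp
  qed
  then have "(\<forall>(A, B)\<in>\<G>. x \<inter> A \<noteq> B) \<longleftrightarrow> (\<forall>(A, B)\<in>\<G>. y \<inter> A \<noteq> B)"
    by (intro ball_cong) auto
  then show ?thesis
    unfolding R by simp
qed

lemma closed_below_cut: "(\<And>\<gamma>. \<gamma> < \<beta> \<Longrightarrow> closed_below \<gamma> (F \<gamma>)) \<Longrightarrow> closed_below \<gamma> (cut_below F \<beta> \<gamma>)"
  by (simp add: cut_below_def closed_below_empty)

lemma empty_in_points: "{} \<in> points F"
  by (simp add: points_def)

lemma points_cut_below_subset: "x \<in> points (cut_below F \<beta>) \<Longrightarrow> x \<subseteq> {..<\<beta>}"
  by (auto simp: points_def cut_below_def split: if_splits)

lemma points_cut_below:
  assumes "\<And>\<gamma>. closed_below \<gamma> (F \<gamma>)"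
  shows "x \<in> points F \<Longrightarrow> x \<inter> {..<\<beta>} \<in> points (cut_below F \<beta>)"
    and "x \<in> points (cut_below F \<beta>) \<Longrightarrow> x \<in> points F \<and> x \<subseteq> {..<\<beta>}"
proof -
  show "x \<inter> {..<\<beta>} \<in> points (cut_below F \<beta>)" if "x \<in> points F"
    unfolding points_def
  proof clarify
    fix \<gamma> assume \<gamma>: "\<gamma> \<in> x" "\<gamma> < \<beta>"
    then have "x \<inter> {..<\<beta>} \<inter> {..<\<gamma>} = x \<inter> {..<\<gamma>}" by auto
    from closed_below_cong[OF assms this] \<gamma> that show "x \<inter> {..<\<beta>} \<in> cut_below F \<beta> \<gamma>"
      by (simp add: points_def cut_below_def)
  qed
  show "x \<in> points (cut_below F \<beta>) \<Longrightarrow> x \<in> points F \<and> x \<subseteq> {..<\<beta>}"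
    by (auto simp: points_def cut_below_def split: if_splits)
qed

lemma points_restrict: "(\<And>\<gamma>. closed_below \<gamma> (F \<gamma>)) \<Longrightarrow> x \<in> points F \<Longrightarrow> x \<inter> {..<\<beta>} \<in> points F"
  using points_cut_below by blast

lemma cut_below_cut_below: "\<gamma> \<le> \<beta> \<Longrightarrow> cut_below (cut_below F \<beta>) \<gamma> = cut_below F \<gamma>"
  by (auto simp: cut_below_def fun_eq_iff)

lemma kept_iff:
  assumes "\<And>\<gamma>. closed_below \<gamma> (F \<gamma>)"
  shows "\<beta> \<in> random_point F \<epsilon> \<longleftrightarrow> \<epsilon> \<beta> \<and> random_point F \<epsilon> \<in> F \<beta>"
proof -
  have "{\<gamma>. \<gamma> < \<beta> \<and> kept F \<epsilon> \<gamma>} \<in> F \<beta> \<longleftrightarrow> random_point F \<epsilon> \<in> F \<beta>"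
    by (rule closed_below_cong[OF assms]) (auto simp: random_point_def)
  then show ?thesis by (simp add: random_point_def kept.simps[of F \<epsilon> \<beta>])
qed

lemma random_point_in_points: "(\<And>\<gamma>. closed_below \<gamma> (F \<gamma>)) \<Longrightarrow> random_point F \<epsilon> \<in> points F"
  by (auto simp: points_def kept_iff)

lemma random_point_cut_below:
  assumes "\<And>\<gamma>. closed_below \<gamma> (F \<gamma>)"
  shows "random_point (cut_below F \<beta>) \<epsilon> = random_point F \<epsilon> \<inter> {..<\<beta>}"
proof -
  have c: "closed_below \<gamma> (cut_below F \<beta> \<gamma>)" for \<gamma>
    using assms by (intro closed_below_cut)
  have "\<gamma> \<in> random_point (cut_below F \<beta>) \<epsilon> \<longleftrightarrow> \<gamma> \<in> random_point F \<epsilon>" if "\<gamma> < \<beta>" for \<gamma>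
    using that
  proof (induction \<gamma> rule: less_induct)
    case (less \<gamma>)
    have "random_point (cut_below F \<beta>) \<epsilon> \<in> F \<gamma> \<longleftrightarrow> random_point F \<epsilon> \<in> F \<gamma>"
      using less by (intro closed_below_cong[OF assms]) auto
    moreover have "cut_below F \<beta> \<gamma> = F \<gamma>"
      using less.prems by (simp add: cut_below_def)
    ultimately show ?case
      by (simp add: kept_iff[OF c] kept_iff[OF assms])
  qed
  moreover have "random_point (cut_below F \<beta>) \<epsilon> \<subseteq> {..<\<beta>}"
    by (rule points_cut_below_subset[OF random_point_in_points[OF c]])
  ultimately show ?thesis by auto
qed

lemma random_point_local:
  assumes cl: "\<And>\<gamma>. closed_below \<gamma> (F \<gamma>)" and "\<And>\<gamma>. \<gamma> < \<beta> \<Longrightarrow> \<epsilon> \<gamma> = \<epsilon>' \<gamma>"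
  shows "random_point F \<epsilon> \<inter> {..<\<beta>} = random_point F \<epsilon>' \<inter> {..<\<beta>}"
proof -
  have "\<gamma> \<in> random_point F \<epsilon> \<longleftrightarrow> \<gamma> \<in> random_point F \<epsilon>'" if "\<gamma> < \<beta>" for \<gamma>
    using that
  proof (induction \<gamma> rule: less_induct)
    case (less \<gamma>)
    have "random_point F \<epsilon> \<in> F \<gamma> \<longleftrightarrow> random_point F \<epsilon>' \<in> F \<gamma>"
      using less by (intro closed_below_cong[OF cl]) auto
    then show ?case
      using less.prems assms(2) by (simp add: kept_iff[OF cl])
  qed
  then show ?thesis by auto
qed

section \<open>Fair coins\<close>

definition coins :: "(omega1 \<Rightarrow> bool) measure" where
  "coins = (\<Pi>\<^sub>M \<beta>\<in>UNIV. uniform_count_measure (UNIV :: bool set))"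

lemma prob_space_coin: "prob_space (uniform_count_measure (UNIV :: bool set))"
  by (rule prob_space_uniform_count_measure) auto

interpretation coins: prob_space coins
  unfolding coins_def by (intro prob_space_PiM prob_space_coin)

lemma space_coins [simp]: "space coins = UNIV"
  by (simp add: coins_def space_PiM space_uniform_count_measure)

lemma sets_coin: "sets (uniform_count_measure (UNIV :: bool set)) = UNIV"
  by (simp add: sets_uniform_count_measure)

lemma measurable_coin: "{\<epsilon>. \<epsilon> \<beta> = i} \<in> sets coins"
proof -
  have "(\<lambda>\<epsilon>. \<epsilon> \<beta>) \<in> measurable coins (uniform_count_measure UNIV)"
    unfolding coins_def by (rule measurable_component_singleton) simp
  then have "(\<lambda>\<epsilon>. \<epsilon> \<beta>) -` {i} \<inter> space coins \<in> sets coins"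
    by (rule measurable_sets) (simp add: sets_coin)
  then show ?thesis by (simp add: vimage_def)
qed

lemma flip_measurable: "(\<lambda>\<epsilon>. \<epsilon>(\<beta> := \<not> \<epsilon> \<beta>)) \<in> measurable coins coins"
proof -
  let ?C = "uniform_count_measure (UNIV :: bool set)"
  have *: "(\<lambda>\<epsilon>. \<epsilon> \<gamma>) \<in> measurable coins ?C" for \<gamma>
    unfolding coins_def by (rule measurable_component_singleton) simp
  have n: "Not \<in> measurable ?C ?C"
    by (rule measurableI) (auto simp: sets_coin space_uniform_count_measure)
  have "(\<lambda>\<epsilon>. (\<epsilon>(\<beta> := \<not> \<epsilon> \<beta>)) \<gamma>) \<in> measurable coins ?C" for \<gamma>
    using * measurable_compose[OF * n] by (cases "\<gamma> = \<beta>") auto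
  then show ?thesis
    by (subst (2) coins_def) (rule measurable_PiM_single', auto simp: space_uniform_count_measure)
qed

text \<open>Turning over the coin at \<open>\<beta>\<close> preserves the measure. This replaces independence: an event that
  does not depend on that coin is divided by it into two halves, which the flip exchanges.\<close>

lemma distr_flip: "distr coins coins (\<lambda>\<epsilon>. \<epsilon>(\<beta> := \<not> \<epsilon> \<beta>)) = coins"
proof -
  let ?T = "\<lambda>\<epsilon> :: omega1 \<Rightarrow> bool. \<epsilon>(\<beta> := \<not> \<epsilon> \<beta>)"
  let ?C = "\<lambda>_ :: omega1. uniform_count_measure (UNIV :: bool set)"
  have s: "sets coins = sets (PiM UNIV ?C)" by (simp add: coins_def)
  show ?thesis
  proof (rule measure_eqI_PiM_infinite[where I = UNIV and M = ?C])
    show "finite_measure (distr coins coins ?T)"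
      by (intro prob_space.finite_measure coins.prob_space_distr flip_measurable)
    fix A :: "omega1 \<Rightarrow> bool set" and J :: "omega1 set"
    assume J: "finite J"
    define A' where "A' = A(\<beta> := Not -` A \<beta>)"
    have cube: "prod_emb UNIV ?C J (Pi\<^sub>E J X) = {\<epsilon>. \<forall>\<gamma>\<in>J. \<epsilon> \<gamma> \<in> X \<gamma>}" for X
      by (auto simp: prod_emb_def PiE_iff space_uniform_count_measure)
    have e: "emeasure coins {\<epsilon>. \<forall>\<gamma>\<in>J. \<epsilon> \<gamma> \<in> X \<gamma>} = (\<Prod>\<gamma>\<in>J. emeasure (?C \<gamma>) (X \<gamma>))" for X
      unfolding cube[symmetric] coins_def
      using J by (intro emeasure_PiM_emb prob_space_coin) (auto simp: sets_coin)
    have m: "{\<epsilon>. \<forall>\<gamma>\<in>J. \<epsilon> \<gamma> \<in> A \<gamma>} \<in> sets coins"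
      unfolding cube[symmetric] s using J by (intro sets_PiM_I) (auto simp: sets_coin)
    have "emeasure (distr coins coins ?T) {\<epsilon>. \<forall>\<gamma>\<in>J. \<epsilon> \<gamma> \<in> A \<gamma>}
        = emeasure coins (?T -` {\<epsilon>. \<forall>\<gamma>\<in>J. \<epsilon> \<gamma> \<in> A \<gamma>} \<inter> space coins)"
      by (rule emeasure_distr[OF flip_measurable m])
    also have "?T -` {\<epsilon>. \<forall>\<gamma>\<in>J. \<epsilon> \<gamma> \<in> A \<gamma>} \<inter> space coins = {\<epsilon>. \<forall>\<gamma>\<in>J. \<epsilon> \<gamma> \<in> A' \<gamma>}"
      by (auto simp: A'_def)
    also have "emeasure coins \<dots> = (\<Prod>\<gamma>\<in>J. emeasure (?C \<gamma>) (A' \<gamma>))"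
      by (rule e)
    also have "\<dots> = (\<Prod>\<gamma>\<in>J. emeasure (?C \<gamma>) (A \<gamma>))"
    proof (rule prod.cong[OF refl])
      fix \<gamma>
      have "card (Not -` A \<beta>) = card (A \<beta>)"
        by (rule card_vimage_inj) (auto simp: inj_def surj_def)
      then show "emeasure (?C \<gamma>) (A' \<gamma>) = emeasure (?C \<gamma>) (A \<gamma>)"
        by (simp add: A'_def emeasure_uniform_count_measure)
    qed
    also have "\<dots> = emeasure coins {\<epsilon>. \<forall>\<gamma>\<in>J. \<epsilon> \<gamma> \<in> A \<gamma>}"
      by (rule e[symmetric])
    finally show "emeasure (distr coins coins ?T) (prod_emb UNIV ?C J (Pi\<^sub>E J A))
        = emeasure coins (prod_emb UNIV ?C J (Pi\<^sub>E J A))"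
      unfolding cube .
  qed (simp_all add: s)
qed

lemma coins_half:
  assumes A: "A \<in> sets coins" and inv: "\<And>\<epsilon>. \<epsilon> \<in> A \<Longrightarrow> \<epsilon>(\<beta> := \<not> \<epsilon> \<beta>) \<in> A"
  shows "measure coins (A \<inter> {\<epsilon>. \<epsilon> \<beta> = i}) = measure coins A / 2"
proof -
  let ?T = "\<lambda>\<epsilon> :: omega1 \<Rightarrow> bool. \<epsilon>(\<beta> := \<not> \<epsilon> \<beta>)"
  have m: "A \<inter> {\<epsilon>. \<epsilon> \<beta> = k} \<in> sets coins" for k
    using A measurable_coin by auto
  have "?T \<epsilon> \<in> A \<longleftrightarrow> \<epsilon> \<in> A" for \<epsilon>
    using inv[of \<epsilon>] inv[of "?T \<epsilon>"] by auto
  then have "?T -` (A \<inter> {\<epsilon>. \<epsilon> \<beta> = i}) \<inter> space coins = A \<inter> {\<epsilon>. \<epsilon> \<beta> = (\<not> i)}"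
    by auto
  then have "measure coins (A \<inter> {\<epsilon>. \<epsilon> \<beta> = i}) = measure coins (A \<inter> {\<epsilon>. \<epsilon> \<beta> = (\<not> i)})"
    using measure_distr[OF flip_measurable m[of i], of \<beta>] unfolding distr_flip by simp
  moreover have "measure coins A
      = measure coins (A \<inter> {\<epsilon>. \<epsilon> \<beta> = i}) + measure coins (A \<inter> {\<epsilon>. \<epsilon> \<beta> = (\<not> i)})"
    by (subst coins.finite_measure_Union[symmetric]) (auto intro: m arg_cong[where f = "measure coins"])
  ultimately show ?thesis by simp
qed

lemma coins_cube:
  fixes L :: "'i set"
  assumes "finite L" "inj_on j L"
  shows "{\<epsilon>. \<forall>l\<in>L. \<epsilon> (j l) = q l} \<in> sets coins \<and>
    measure coins {\<epsilon>. \<forall>l\<in>L. \<epsilon> (j l) = q l} = (1 / 2) ^ card L"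
  using assms
proof (induction L)
  case empty
  then show ?case using coins.prob_space sets.top[of coins] by simp
next
  case (insert a L)
  let ?E = "{\<epsilon>. \<forall>l\<in>L. \<epsilon> (j l) = q l}"
  have eq: "{\<epsilon>. \<forall>l\<in>insert a L. \<epsilon> (j l) = q l} = ?E \<inter> {\<epsilon>. \<epsilon> (j a) = q a}"
    by auto
  have E: "?E \<in> sets coins" "measure coins ?E = (1 / 2) ^ card L"
    using insert by auto
  have "measure coins (?E \<inter> {\<epsilon>. \<epsilon> (j a) = q a}) = measure coins ?E / 2"
    using insert.hyps insert.prems by (intro coins_half E) (auto simp: inj_on_def)
  then show ?case
    unfolding eq using E measurable_coin insert.hyps by auto
qed

section \<open>Strictly positive measures\<close>

lemma measurable_random_point_Int:
  assumes "finite A" "\<And>\<gamma>. \<gamma> \<in> A \<Longrightarrow> {\<epsilon>. \<gamma> \<in> random_point F \<epsilon>} \<in> sets coins"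
  shows "{\<epsilon>. random_point F \<epsilon> \<inter> A = B} \<in> sets coins"
proof (cases "B \<subseteq> A")
  case True
  then have eq: "{\<epsilon>. random_point F \<epsilon> \<inter> A = B} =
      {\<epsilon> \<in> space coins. \<forall>\<gamma>\<in>A. \<gamma> \<in> random_point F \<epsilon> \<longleftrightarrow> \<gamma> \<in> B}"
    by auto
  have "{\<epsilon> \<in> space coins. \<gamma> \<in> random_point F \<epsilon> \<longleftrightarrow> \<gamma> \<in> B} \<in> sets coins" if "\<gamma> \<in> A" for \<gamma>
    using assms(2)[OF that] sets.compl_sets[OF assms(2)[OF that]]
    by (cases "\<gamma> \<in> B") (simp_all add: Collect_neg_eq Compl_eq_Diff_UNIV)
  then show ?thesis
    unfolding eq using assms(1) by (intro sets.sets_Collect_finite_All) auto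
next
  case False
  then have "{\<epsilon>. random_point F \<epsilon> \<inter> A = B} = {}" by auto
  then show ?thesis by simp
qed

lemma countable_conditions: "countable {(A, B). finite A \<and> A \<subseteq> {..<(\<beta> :: omega1)} \<and> B \<subseteq> A}"
proof (rule countable_subset)
  let ?C = "{A. finite A \<and> A \<subseteq> {..<\<beta>}}"
  show "{(A, B). finite A \<and> A \<subseteq> {..<\<beta>} \<and> B \<subseteq> A} \<subseteq> ?C \<times> ?C"
    by (auto intro: finite_subset)
  have "countable ?C"
    by (rule countable_Collect_finite_subset[OF countable_lessThan_omega1])
  then show "countable (?C \<times> ?C)" by blast
qed

lemma measurable_closed_below:
  assumes "closed_below \<beta> R" "\<And>\<gamma>. \<gamma> < \<beta> \<Longrightarrow> {\<epsilon>. \<gamma> \<in> random_point F \<epsilon>} \<in> sets coins"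
  shows "{\<epsilon>. random_point F \<epsilon> \<in> R} \<in> sets coins"
proof -
  obtain \<G> where \<G>: "\<forall>(A, B)\<in>\<G>. finite A \<and> A \<subseteq> {..<\<beta>} \<and> B \<subseteq> A"
    and R: "R = {x. \<forall>(A, B)\<in>\<G>. x \<inter> A \<noteq> B}"
    using assms(1) unfolding closed_below_def by blast
  have "countable \<G>"
    by (rule countable_subset[OF _ countable_conditions[of \<beta>]]) (use \<G> in auto)
  moreover have "{\<epsilon>. random_point F \<epsilon> \<inter> A = B} \<in> sets coins" if "(A, B) \<in> \<G>" for A B
    using \<G> that by (intro measurable_random_point_Int assms(2)) auto
  ultimately have "(\<Union>(A, B)\<in>\<G>. {\<epsilon>. random_point F \<epsilon> \<inter> A = B}) \<in> sets coins"
    by (intro sets.countable_UN') auto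
  then have "space coins - (\<Union>(A, B)\<in>\<G>. {\<epsilon>. random_point F \<epsilon> \<inter> A = B}) \<in> sets coins"
    by (rule sets.compl_sets)
  also have "space coins - (\<Union>(A, B)\<in>\<G>. {\<epsilon>. random_point F \<epsilon> \<inter> A = B}) = {\<epsilon>. random_point F \<epsilon> \<in> R}"
    unfolding R by auto
  finally show ?thesis .
qed

text \<open>Induction along \<open>\<omega>\<^sub>1\<close> works because each stage looks at countably many earlier coordinates only.\<close>

lemma measurable_random_point:
  assumes cl: "\<And>\<gamma>. closed_below \<gamma> (F \<gamma>)"
  shows "{\<epsilon>. \<beta> \<in> random_point F \<epsilon>} \<in> sets coins"
proof (induction \<beta> rule: less_induct)
  case (less \<beta>)
  have "{\<epsilon>. \<beta> \<in> random_point F \<epsilon>} = {\<epsilon>. \<epsilon> \<beta> = True} \<inter> {\<epsilon>. random_point F \<epsilon> \<in> F \<beta>}"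
    by (auto simp: kept_iff[OF cl])
  then show ?case
    using measurable_coin[of \<beta> True] measurable_closed_below[OF cl less] by auto
qed

text \<open>The law of the random point, restricted to \<open>R\<close>, gives positive mass to every nonempty relatively
  open subset of \<open>R \<inter> points F\<close>; its basic open subsets are the cylinders around a point \<open>x\<close>.\<close>

definition supported :: "(omega1 \<Rightarrow> omega1 set set) \<Rightarrow> omega1 set set \<Rightarrow> bool" where
  "supported F R \<longleftrightarrow>
     (\<forall>A x. finite A \<and> x \<in> R \<inter> points F \<longrightarrow>
        measure coins {\<epsilon>. random_point F \<epsilon> \<inter> A = x \<inter> A \<and> random_point F \<epsilon> \<in> R} > 0)"

text \<open>Positivity passes from the stages to the whole space by induction on the largest coordinate \<open>b\<close> of
  a finite condition. If the condition excludes \<open>b\<close>, tails at \<open>b\<close> realizes it with half the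
  probability of the remaining condition. If it demands \<open>b\<close>, then the remaining condition meets
  \<open>F b\<close>; it does so with positive probability by the assumption on stage \<open>b\<close>, and heads at \<open>b\<close>
  costs another factor of two.\<close>

lemma supported_UNIV:
  assumes cl: "\<And>\<gamma>. closed_below \<gamma> (F \<gamma>)" and sup: "\<And>\<beta>. supported (cut_below F \<beta>) (F \<beta>)"
  shows "supported F UNIV"
proof -
  have "measure coins {\<epsilon>. random_point F \<epsilon> \<inter> A = x \<inter> A} > 0"
    if "finite A" and x: "x \<in> points F" for A x
    using that(1)
  proof (induction rule: finite_linorder_max_induct)
    case empty
    then show ?case using coins.prob_space by simp
  next
    case (insert b A)
    have A: "A \<subseteq> {..<b}" using insert by auto
    have mA: "{\<epsilon>. random_point F \<epsilon> \<inter> A = B} \<in> sets coins" for B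
      using insert(1) by (intro measurable_random_point_Int measurable_random_point cl)
    have flip: "random_point F (\<epsilon>(b := i)) \<inter> {..<b} = random_point F \<epsilon> \<inter> {..<b}" for \<epsilon> i
      by (rule random_point_local[OF cl]) auto
    then have flipA: "random_point F (\<epsilon>(b := i)) \<inter> A = random_point F \<epsilon> \<inter> A" for \<epsilon> i
      using A by blast
    have flipR: "random_point F (\<epsilon>(b := i)) \<in> F b \<longleftrightarrow> random_point F \<epsilon> \<in> F b" for \<epsilon> i
      by (rule closed_below_cong[OF cl flip])
    have m: "{\<epsilon>. random_point F \<epsilon> \<inter> insert b A = x \<inter> insert b A} \<in> sets coins"
      using insert(1) by (intro measurable_random_point_Int measurable_random_point cl) auto
    have b: "b \<in> random_point F \<epsilon> \<longleftrightarrow> \<epsilon> b \<and> random_point F \<epsilon> \<in> F b" for \<epsilon>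
      by (rule kept_iff[OF cl])
    show ?case
    proof (cases "b \<in> x")
      case False
      let ?E = "{\<epsilon>. random_point F \<epsilon> \<inter> A = x \<inter> A}"
      have "0 < measure coins ?E / 2" using insert by simp
      also have "\<dots> = measure coins (?E \<inter> {\<epsilon>. \<epsilon> b = False})"
        by (rule coins_half[symmetric, OF mA]) (simp add: flipA)
      also have "\<dots> \<le> measure coins {\<epsilon>. random_point F \<epsilon> \<inter> insert b A = x \<inter> insert b A}"
        using False by (intro coins.finite_measure_mono m) (auto simp: b Int_insert_right)
      finally show ?thesis .
    next
      case True
      let ?E = "{\<epsilon>. random_point F \<epsilon> \<inter> A = x \<inter> A} \<inter> {\<epsilon>. random_point F \<epsilon> \<in> F b}"
      have E: "?E \<in> sets coins"
        by (intro sets.Int mA measurable_closed_below[OF cl] measurable_random_point[OF cl])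
      have "x \<inter> {..<b} \<inter> {..<b} = x \<inter> {..<b}" by blast
      from closed_below_cong[OF cl[of b] this] have "x \<inter> {..<b} \<in> F b"
        using True x by (auto simp: points_def)
      moreover have "x \<inter> {..<b} \<in> points (cut_below F b)"
        by (rule points_cut_below(1)[OF cl x])
      ultimately have "0 < measure coins {\<epsilon>. random_point (cut_below F b) \<epsilon> \<inter> A = x \<inter> {..<b} \<inter> A \<and>
          random_point (cut_below F b) \<epsilon> \<in> F b}"
        using sup[of b] insert(1) unfolding supported_def by blast
      also have "{\<epsilon>. random_point (cut_below F b) \<epsilon> \<inter> A = x \<inter> {..<b} \<inter> A \<and>
          random_point (cut_below F b) \<epsilon> \<in> F b} = ?E"
      proof -
        have "random_point (cut_below F b) \<epsilon> \<in> F b \<longleftrightarrow> random_point F \<epsilon> \<in> F b" for \<epsilon>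
          by (rule closed_below_cong[OF cl]) (auto simp: random_point_cut_below[OF cl])
        moreover have "random_point (cut_below F b) \<epsilon> \<inter> A = x \<inter> {..<b} \<inter> A \<longleftrightarrow>
            random_point F \<epsilon> \<inter> A = x \<inter> A" for \<epsilon>
          using A unfolding random_point_cut_below[OF cl] by (simp add: Int_assoc inf.absorb2)
        ultimately show ?thesis by auto
      qed
      finally have "0 < measure coins ?E / 2" by simp
      also have "\<dots> = measure coins (?E \<inter> {\<epsilon>. \<epsilon> b = True})"
        by (rule coins_half[symmetric, OF E]) (simp add: flipA flipR)
      also have "\<dots> \<le> measure coins {\<epsilon>. random_point F \<epsilon> \<inter> insert b A = x \<inter> insert b A}"
        using True by (intro coins.finite_measure_mono m) (auto simp: b Int_insert_right)
      finally show ?thesis .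
    qed
  qed
  then show ?thesis by (auto simp: supported_def)
qed

text \<open>The single step of the recursion, with \<open>\<N>\<close> the set of forbidden traces. The complement \<open>R'\<close> of small
  cylinders around them fills at least half of every neighbourhood \<open>U k\<close> of \<open>w\<close>. Removing from
  \<open>R'\<close> the null cylinders changes it by a null set and leaves a set that supports its own measure,
  in which \<open>w\<close> survives since no neighbourhood of \<open>w\<close> is null. A small cylinder around a trace is
  obtained by fixing sufficiently many of the unrestricted coordinates \<open>j l\<close>, and one more
  coordinate \<open>\<xi>\<close> at which the trace differs from \<open>w\<close>.\<close>

lemma exists_supported:
  fixes w :: "omega1 set" and j :: "nat \<Rightarrow> omega1"
  assumes cl: "\<And>\<gamma>. closed_below \<gamma> (F \<gamma>)"
    and top: "\<And>\<gamma>. \<beta> \<le> \<gamma> \<Longrightarrow> F \<gamma> = {}"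
    and pos: "supported F UNIV"
    and w: "w \<in> points F"
    and j: "inj j" "range j \<subseteq> {..<\<alpha>0}" "\<And>l. F (j l) = UNIV"
    and N: "countable \<N>"
      "\<And>\<alpha> z. (\<alpha>, z) \<in> \<N> \<Longrightarrow> \<alpha>0 \<le> \<alpha> \<and> \<alpha> \<le> \<beta> \<and> z \<inter> {..<\<alpha>} \<noteq> w \<inter> {..<\<alpha>}"
  shows "\<exists>R. closed_below \<beta> R \<and> supported F R \<and> w \<in> R \<and>
    (\<forall>\<alpha> z x. (\<alpha>, z) \<in> \<N> \<longrightarrow> x \<in> R \<longrightarrow> x \<inter> {..<\<alpha>} \<noteq> z \<inter> {..<\<alpha>})"
proof -
  have below: "x \<subseteq> {..<\<beta>}" if "x \<in> points F" for x
    using that top by (force simp: points_def not_less[symmetric])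
  have mI: "finite A \<Longrightarrow> {\<epsilon>. random_point F \<epsilon> \<inter> A = B} \<in> sets coins" for A B
    by (intro measurable_random_point_Int measurable_random_point cl)
  have mC: "{\<epsilon>. random_point F \<epsilon> \<in> R} \<in> sets coins" if "closed_below \<beta> R" for R
    by (intro measurable_closed_below[OF that] measurable_random_point cl)
  have jw: "j l \<in> random_point F \<epsilon> \<longleftrightarrow> \<epsilon> (j l)" for l \<epsilon>
    using j(3) by (simp add: kept_iff[OF cl])
  \<comment> \<open>The finite sets \<open>V k\<close> exhaust the coordinates below \<open>\<beta>\<close>, so the \<open>U k\<close> below
      are the events given by a decreasing base of neighbourhoods of \<open>w\<close>.\<close>
  define V where "V k = {\<gamma> \<in> {..<\<beta>}. to_nat_on {..<\<beta>} \<gamma> < k}" for k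
  have V_fin: "finite (V k)" for k
  proof -
    have "V k = to_nat_on {..<\<beta>} -` {..<k} \<inter> {..<\<beta>}"
      unfolding V_def by blast
    then show ?thesis
      by (simp add: finite_vimage_IntI inj_on_to_nat_on countable_lessThan_omega1)
  qed
  have V_mono: "k \<le> k' \<Longrightarrow> V k \<subseteq> V k'" for k k'
    unfolding V_def by auto
  have V_all: "\<exists>k. A \<subseteq> V k" if "finite A" "A \<subseteq> {..<\<beta>}" for A
  proof -
    have "finite (to_nat_on {..<\<beta>} ` A)" using that(1) by simp
    then obtain k where "to_nat_on {..<\<beta>} ` A \<subseteq> {..<k}"
      unfolding finite_nat_iff_bounded by blast
    then have "A \<subseteq> V k" using that(2) unfolding V_def by blast
    then show ?thesis by blast
  qed
  define U where "U k = {\<epsilon>. random_point F \<epsilon> \<inter> V k = w \<inter> V k}" for k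
  define u where "u k = measure coins (U k)" for k
  have U: "U k \<in> sets coins" for k
    unfolding U_def by (rule mI[OF V_fin])
  have u_pos: "0 < u k" for k
  proof -
    have "finite (V k) \<and> w \<in> UNIV \<inter> points F" using V_fin w by simp
    with pos show ?thesis
      unfolding supported_def u_def U_def by fastforce
  qed
  have u_mono: "u k' \<le> u k" if "k \<le> k'" for k k'
    unfolding u_def
  proof (rule coins.finite_measure_mono[OF _ U])
    show "U k' \<subseteq> U k"
      unfolding U_def using V_mono[OF that] by blast
  qed
  obtain f where f: "\<N> \<subseteq> range (f :: nat \<Rightarrow> omega1 \<times> omega1 set)"
    using N(1) by (metis empty_subsetI range_from_nat_into subset_refl)
  define I where "I = {i. f i \<in> \<N>}"
  define a where "a i = fst (f i)" for i
  define z where "z i = snd (f i)" for i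
  have a: "\<alpha>0 \<le> a i" "a i \<le> \<beta>" "z i \<inter> {..<a i} \<noteq> w \<inter> {..<a i}" if "i \<in> I" for i
    using N(2)[of "a i" "z i"] that by (auto simp: I_def a_def z_def)
  \<comment> \<open>The \<open>i\<close>-th cylinder is disjoint from \<open>U k\<close> as soon as \<open>\<xi> \<in> V k\<close>. So it meets only \<open>U k'\<close>
      with \<open>k' < k\<close>, whose probability is at least \<open>u k\<close>. This makes its size
      \<open>u k / 2 ^ (i + 2)\<close> summable to half of \<open>u k'\<close>, for all \<open>k'\<close> at once.\<close>
  have "\<exists>\<xi> k m. i \<in> I \<longrightarrow> \<xi> < a i \<and> (\<xi> \<in> z i \<longleftrightarrow> \<xi> \<notin> w) \<and> \<xi> \<in> V k \<and>
      (1 / 2) ^ m \<le> u k * (1 / 2) ^ (i + 2)" for i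
  proof (cases "i \<in> I")
    case True
    then obtain \<xi> where \<xi>: "\<xi> < a i" "\<xi> \<in> z i \<longleftrightarrow> \<xi> \<notin> w"
      using a(3)[OF True] by blast
    with a(2)[OF True] have "\<xi> < \<beta>" by simp
    then obtain k where "\<xi> \<in> V k"
      using V_all[of "{\<xi>}"] by auto
    moreover have "0 < u k * (1 / 2) ^ (i + 2)"
      using u_pos by simp
    then obtain m where "(1 / 2) ^ m < u k * (1 / 2) ^ (i + 2)"
      using real_arch_pow_inv[of _ "1 / 2"] by fastforce
    ultimately show ?thesis using \<xi> less_imp_le by blast
  qed auto
  then obtain \<xi> \<kappa> m where \<xi>: "\<And>i. i \<in> I \<Longrightarrow> \<xi> i < a i" "\<And>i. i \<in> I \<Longrightarrow> \<xi> i \<in> z i \<longleftrightarrow> \<xi> i \<notin> w"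
    "\<And>i. i \<in> I \<Longrightarrow> \<xi> i \<in> V (\<kappa> i)" "\<And>i. i \<in> I \<Longrightarrow> (1 / 2) ^ m i \<le> u (\<kappa> i) * (1 / 2) ^ (i + 2)"
    by metis
  define A where "A i = insert (\<xi> i) (j ` {..<m i})" for i
  have A: "finite (A i)" "A i \<subseteq> {..<a i}" if "i \<in> I" for i
    using \<xi>(1)[OF that] j(2) a(1)[OF that] by (auto simp: A_def intro: less_le_trans)
  have A': "A i \<subseteq> {..<\<beta>}" if "i \<in> I" for i
    using A(2)[OF that] a(2)[OF that] by (meson lessThan_subset_iff order_trans)
  define R' where "R' = {x. \<forall>i\<in>I. x \<inter> A i \<noteq> z i \<inter> A i}"
  have R': "closed_below \<beta> R'"
    unfolding closed_below_def
  proof (intro exI conjI)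
    show "\<forall>(X, Y)\<in>(\<lambda>i. (A i, z i \<inter> A i)) ` I. finite X \<and> X \<subseteq> {..<\<beta>} \<and> Y \<subseteq> X"
      using A(1) A' by blast
    show "R' = {x. \<forall>(X, Y)\<in>(\<lambda>i. (A i, z i \<inter> A i)) ` I. x \<inter> X \<noteq> Y}"
      by (auto simp: R'_def)
  qed
  have half: "u k / 2 \<le> measure coins (U k \<inter> {\<epsilon>. random_point F \<epsilon> \<in> R'})" for k
  proof -
    define H where
      "H i = (if i \<in> I then U k \<inter> {\<epsilon>. random_point F \<epsilon> \<inter> A i = z i \<inter> A i} else {})" for i
    have H: "H i \<in> sets coins" for i
      unfolding H_def using U mI A(1) by auto
    have bound: "measure coins (H i) \<le> u k * (1 / 2) ^ (i + 2)" for i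
    proof (cases "i \<in> I \<and> \<xi> i \<notin> V k")
      case True
      then have i: "i \<in> I" "\<xi> i \<notin> V k" by auto
      have "k \<le> \<kappa> i"
        using V_mono[of "\<kappa> i" k] \<xi>(3)[OF i(1)] i(2) by (meson le_cases subsetD)
      have sub: "H i \<subseteq> {\<epsilon>. \<forall>l\<in>{..<m i}. \<epsilon> (j l) = (j l \<in> z i)}"
        using i by (auto simp: H_def A_def jw[symmetric])
      have cube: "{\<epsilon>. \<forall>l\<in>{..<m i}. \<epsilon> (j l) = (j l \<in> z i)} \<in> sets coins"
        "measure coins {\<epsilon>. \<forall>l\<in>{..<m i}. \<epsilon> (j l) = (j l \<in> z i)} = (1 / 2) ^ m i"
        using coins_cube[OF finite_lessThan inj_on_subset[OF j(1) subset_UNIV], where q = "\<lambda>l. j l \<in> z i"]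
        by simp_all
      have "measure coins (H i) \<le> (1 / 2) ^ m i"
        using coins.finite_measure_mono[OF sub cube(1)] cube(2) by simp
      also have "\<dots> \<le> u (\<kappa> i) * (1 / 2) ^ (i + 2)"
        by (rule \<xi>(4)[OF i(1)])
      also have "\<dots> \<le> u k * (1 / 2) ^ (i + 2)"
        by (intro mult_right_mono u_mono \<open>k \<le> \<kappa> i\<close>) auto
      finally show ?thesis .
    next
      case False
      have "H i = {}"
      proof (cases "i \<in> I")
        case True
        with False have "\<xi> i \<in> V k" by blast
        with \<xi>(2)[OF True] show ?thesis
          by (auto simp: H_def U_def A_def)
      qed (simp add: H_def)
      then show ?thesis using u_pos[of k] by simp
    qed
    have sums: "(\<lambda>i. u k * (1 / 2) ^ (i + 2)) sums (u k / 2)"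
    proof -
      have "(\<lambda>i. (u k / 4) * (1 / 2) ^ i) sums ((u k / 4) * (1 / (1 - 1 / 2)))"
        by (intro sums_mult geometric_sums) simp
      then show ?thesis by (simp add: power_add)
    qed
    have summ: "summable (\<lambda>i. measure coins (H i))"
      by (rule summable_comparison_test'[OF sums_summable[OF sums], of 0]) (use bound in auto)
    have "measure coins (\<Union>i. H i) \<le> (\<Sum>i. measure coins (H i))"
      using H summ by (intro coins.finite_measure_subadditive_countably) auto
    also have "\<dots> \<le> u k / 2"
      using suminf_le[OF bound summ sums_summable[OF sums]] sums_unique[OF sums] by simp
    finally have "measure coins (\<Union>i. H i) \<le> u k / 2" .
    moreover have "u k \<le> measure coins ((\<Union>i. H i) \<union> (U k \<inter> {\<epsilon>. random_point F \<epsilon> \<in> R'}))"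
      unfolding u_def
    proof (rule coins.finite_measure_mono)
      show "U k \<subseteq> (\<Union>i. H i) \<union> (U k \<inter> {\<epsilon>. random_point F \<epsilon> \<in> R'})"
        by (auto simp: H_def R'_def)
      show "(\<Union>i. H i) \<union> (U k \<inter> {\<epsilon>. random_point F \<epsilon> \<in> R'}) \<in> sets coins"
        using H U mC[OF R'] by auto
    qed
    moreover have "\<dots> \<le> measure coins (\<Union>i. H i) + measure coins (U k \<inter> {\<epsilon>. random_point F \<epsilon> \<in> R'})"
      using H U mC[OF R'] by (intro measure_Un_le) auto
    ultimately show ?thesis by simp
  qed
  \<comment> \<open>Passing from \<open>R'\<close> to the support of the measure on it.\<close>
  define \<Z> where "\<Z> = {(X, Y). finite X \<and> X \<subseteq> {..<\<beta>} \<and> Y \<subseteq> X \<and>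
      measure coins {\<epsilon>. random_point F \<epsilon> \<inter> X = Y \<and> random_point F \<epsilon> \<in> R'} = 0}"
  define R where "R = R' \<inter> {x. \<forall>(X, Y)\<in>\<Z>. x \<inter> X \<noteq> Y}"
  have R: "closed_below \<beta> R"
    unfolding R_def
  proof (rule closed_below_Int[OF R'])
    show "closed_below \<beta> {x. \<forall>(X, Y)\<in>\<Z>. x \<inter> X \<noteq> Y}"
      unfolding closed_below_def by (rule exI[of _ \<Z>]) (auto simp: \<Z>_def)
  qed
  have m': "{\<epsilon>. random_point F \<epsilon> \<inter> X = Y \<and> random_point F \<epsilon> \<in> R'} \<in> sets coins" if "finite X" for X Y
    using sets.Int[OF mI[OF that] mC[OF R']] by (simp add: Collect_conj_eq)
  define Nul where "Nul = (\<Union>(X, Y)\<in>\<Z>. {\<epsilon>. random_point F \<epsilon> \<inter> X = Y \<and> random_point F \<epsilon> \<in> R'})"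
  have "countable \<Z>"
    by (rule countable_subset[OF _ countable_conditions[of \<beta>]]) (auto simp: \<Z>_def)
  then have Nul: "Nul \<in> null_sets coins"
    unfolding Nul_def
  proof (rule null_sets_UN')
    fix p assume "p \<in> \<Z>"
    then show "(case p of (X, Y) \<Rightarrow> {\<epsilon>. random_point F \<epsilon> \<inter> X = Y \<and> random_point F \<epsilon> \<in> R'}) \<in> null_sets coins"
      using m' by (auto simp: \<Z>_def null_sets_def coins.emeasure_eq_measure)
  qed
  have "supported F R"
    unfolding supported_def
  proof (intro allI impI)
    fix X x :: "omega1 set" assume "finite X \<and> x \<in> R \<inter> points F"
    then have X: "finite X" and x: "x \<in> R" "x \<in> points F" by auto
    let ?X = "X \<inter> {..<\<beta>}"
    let ?E = "{\<epsilon>. random_point F \<epsilon> \<inter> ?X = x \<inter> ?X \<and> random_point F \<epsilon> \<in> R'}"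
    have "(?X, x \<inter> ?X) \<notin> \<Z>" using x by (auto simp: R_def)
    then have "measure coins ?E \<noteq> 0" using X by (auto simp: \<Z>_def)
    then have "0 < measure coins ?E" by (simp add: zero_less_measure_iff)
    also have "\<dots> = measure coins (?E - Nul)"
      using Nul m'[of ?X "x \<inter> ?X"] X by (intro measure_Diff_null_set[symmetric]) auto
    also have "\<dots> \<le> measure coins {\<epsilon>. random_point F \<epsilon> \<inter> X = x \<inter> X \<and> random_point F \<epsilon> \<in> R}"
    proof (rule coins.finite_measure_mono)
      show "{\<epsilon>. random_point F \<epsilon> \<inter> X = x \<inter> X \<and> random_point F \<epsilon> \<in> R} \<in> sets coins"
        using sets.Int[OF mI[OF X] mC[OF R]] by (simp add: Collect_conj_eq)
      have "random_point F \<epsilon> \<inter> X = random_point F \<epsilon> \<inter> ?X" "x \<inter> X = x \<inter> ?X" for \<epsilon>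
        using below[OF random_point_in_points[OF cl]] below[OF x(2)] by blast+
      then show "?E - Nul \<subseteq> {\<epsilon>. random_point F \<epsilon> \<inter> X = x \<inter> X \<and> random_point F \<epsilon> \<in> R}"
        by (auto simp: R_def Nul_def)
    qed
    finally show "0 < measure coins {\<epsilon>. random_point F \<epsilon> \<inter> X = x \<inter> X \<and> random_point F \<epsilon> \<in> R}" .
  qed
  moreover have "w \<in> R"
    unfolding R_def
  proof (intro IntI CollectI ballI)
    show "w \<in> R'" using \<xi>(2) by (auto simp: R'_def A_def)
    fix p assume p: "p \<in> \<Z>"
    obtain X Y where [simp]: "p = (X, Y)" by (cases p)
    have XY: "finite X" "X \<subseteq> {..<\<beta>}"
      "measure coins {\<epsilon>. random_point F \<epsilon> \<inter> X = Y \<and> random_point F \<epsilon> \<in> R'} = 0"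
      using p by (auto simp: \<Z>_def)
    have "w \<inter> X \<noteq> Y"
    proof
      assume eq: "w \<inter> X = Y"
      obtain k where k: "X \<subseteq> V k" using V_all XY by blast
      have "0 < measure coins (U k \<inter> {\<epsilon>. random_point F \<epsilon> \<in> R'})"
        using half[of k] u_pos[of k] by simp
      also have "\<dots> \<le> measure coins {\<epsilon>. random_point F \<epsilon> \<inter> X = Y \<and> random_point F \<epsilon> \<in> R'}"
        using k eq by (intro coins.finite_measure_mono m' XY) (auto simp: U_def)
      finally show False using XY(3) by simp
    qed
    then show "case p of (X, Y) \<Rightarrow> w \<inter> X \<noteq> Y" by simp
  qed
  moreover have "x \<inter> {..<\<alpha>} \<noteq> y \<inter> {..<\<alpha>}" if y: "(\<alpha>, y) \<in> \<N>" and x: "x \<in> R" for \<alpha> y x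
  proof
    assume eq: "x \<inter> {..<\<alpha>} = y \<inter> {..<\<alpha>}"
    obtain i where i: "(\<alpha>, y) = f i" using f y by blast
    then have I: "i \<in> I" "a i = \<alpha>" "z i = y"
      using y by (auto simp: I_def a_def z_def simp flip: i)
    have "x \<inter> A i = z i \<inter> A i"
      using A(2)[OF I(1)] eq I by blast
    with x I show False by (auto simp: R_def R'_def)
  qed
  ultimately show ?thesis using R by blast
qed

section \<open>The recursive construction\<close>

text \<open>The first two conclusions are what compactness and ccc require, the third excludes \<open>G\<^sub>\<delta>\<close> points, and
  the fourth excludes nontrivial sequences converging to uncountable points.

  An entry \<open>E \<beta> = (\<alpha>, z)\<close> of the list has two roles. The set \<open>z 0\<close> is the point \<open>w\<close> to be
  selected at stage \<open>\<beta>\<close>, replaced by \<open>{}\<close> if it is not a point of the truncated system. And if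
  \<open>\<alpha>0 \<le> \<alpha>\<close>, then at every stage that is at least \<open>\<alpha>\<close> and \<open>\<beta>\<close> the sets \<open>z n\<close> are
  forbidden as traces on \<open>\<alpha>\<close>, except for the trace of the point selected at that stage.\<close>

lemma exists_system:
  assumes diamond
  obtains F where "\<And>\<beta>. closed_below \<beta> (F \<beta>)" "\<And>\<beta>. supported (cut_below F \<beta>) (F \<beta>)"
    "\<And>x \<alpha>. x \<in> points F \<Longrightarrow> countable x \<Longrightarrow> \<exists>\<beta>\<ge>\<alpha>. x \<subseteq> {..<\<beta>} \<and> x \<in> F \<beta>"
    "\<And>x y. x \<in> points F \<Longrightarrow> uncountable x \<Longrightarrow> (\<And>n :: nat. y n \<in> points F) \<Longrightarrow> (\<And>n. x \<noteq> y n) \<Longrightarrow>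
       \<exists>\<beta>\<in>x. \<forall>n. \<beta> \<notin> y n"
proof -
  obtain E :: "omega1 \<Rightarrow> omega1 \<times> (nat \<Rightarrow> omega1 set)"
    where E: "\<And>\<alpha> z \<xi>. (\<And>n. z n \<subseteq> {..<\<alpha>}) \<Longrightarrow> \<exists>\<beta>\<ge>\<xi>. E \<beta> = (\<alpha>, z)"
    using diamond_enumeration[OF assms] by metis
  have "infinite (UNIV :: omega1 set)"
    using uncountable_omega1 countable_finite by blast
  then obtain j :: "nat \<Rightarrow> omega1" where j: "inj j"
    by (metis infinite_countable_subset)
  obtain \<alpha>0 where \<alpha>0: "range j \<subseteq> {..<\<alpha>0}"
    by (rule countable_bounded_omega1[of "range j"]) auto
  define w where "w G \<beta> = (if snd (E \<beta>) 0 \<in> points G then snd (E \<beta>) 0 else {})"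
    for G :: "omega1 \<Rightarrow> omega1 set set" and \<beta>
  define avoids where "avoids G \<beta> R \<longleftrightarrow> (\<forall>\<gamma> n x. \<gamma> \<le> \<beta> \<and> \<alpha>0 \<le> fst (E \<gamma>) \<and> fst (E \<gamma>) \<le> \<beta> \<and>
      snd (E \<gamma>) n \<inter> {..<fst (E \<gamma>)} \<noteq> w G \<beta> \<inter> {..<fst (E \<gamma>)} \<and> x \<in> R \<longrightarrow>
      x \<inter> {..<fst (E \<gamma>)} \<noteq> snd (E \<gamma>) n \<inter> {..<fst (E \<gamma>)})" for G \<beta> R
  \<comment> \<open>The coordinates in \<open>range j\<close> stay unrestricted, and the demands start beyond them. The other
      coordinates before \<open>\<alpha>0\<close> will be given \<open>{}\<close>, that is, never used.\<close>
  define P where "P f \<beta> R \<longleftrightarrow> closed_below \<beta> R \<and> supported (cut_below f \<beta>) R \<and>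
      (\<beta> \<in> range j \<longrightarrow> R = UNIV) \<and>
      (\<alpha>0 \<le> \<beta> \<longrightarrow> w (cut_below f \<beta>) \<beta> \<in> R \<and> avoids (cut_below f \<beta>) \<beta> R)" for f \<beta> R
  have "\<exists>F. \<forall>\<beta>. P F \<beta> (F \<beta>)"
  proof (rule dependent_wellorder_choice)
    fix R and f g :: "omega1 \<Rightarrow> omega1 set set" and \<beta>
    assume "\<And>\<gamma>. \<gamma> < \<beta> \<Longrightarrow> f \<gamma> = g \<gamma>"
    then have "cut_below f \<beta> = cut_below g \<beta>"
      by (auto simp: cut_below_def fun_eq_iff)
    then show "P f \<beta> R = P g \<beta> R" by (simp add: P_def)
  next
    fix \<beta> and f :: "omega1 \<Rightarrow> omega1 set set"
    assume IH: "\<And>\<gamma>. \<gamma> < \<beta> \<Longrightarrow> P f \<gamma> (f \<gamma>)"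
    let ?F = "cut_below f \<beta>"
    have cl: "closed_below \<gamma> (?F \<gamma>)" for \<gamma>
      using IH by (intro closed_below_cut) (simp add: P_def)
    have "supported (cut_below ?F \<gamma>) (?F \<gamma>)" for \<gamma>
    proof (cases "\<gamma> < \<beta>")
      case True
      then show ?thesis
        using IH[OF True] cut_below_cut_below[of \<gamma> \<beta> f] by (simp add: P_def) (simp add: cut_below_def)
    qed (simp add: supported_def cut_below_def)
    then have pos: "supported ?F UNIV"
      by (rule supported_UNIV[OF cl])
    consider "\<beta> \<in> range j" | "\<beta> \<notin> range j" "\<beta> < \<alpha>0" | "\<alpha>0 \<le> \<beta>" by force
    then show "\<exists>R. P f \<beta> R"
    proof cases
      case 1
      then have "P f \<beta> UNIV" using \<alpha>0 pos by (auto simp: P_def closed_below_UNIV)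
      then show ?thesis ..
    next
      case 2
      then have "P f \<beta> {}" by (auto simp: P_def closed_below_empty supported_def)
      then show ?thesis ..
    next
      case 3
      let ?w = "w ?F \<beta>"
      define \<N> where "\<N> = {(\<alpha>, z). (\<exists>\<gamma> n. \<gamma> \<le> \<beta> \<and> \<alpha> = fst (E \<gamma>) \<and> z = snd (E \<gamma>) n) \<and>
          \<alpha>0 \<le> \<alpha> \<and> \<alpha> \<le> \<beta> \<and> z \<inter> {..<\<alpha>} \<noteq> ?w \<inter> {..<\<alpha>}}"
      have N1: "countable \<N>"
      proof (rule countable_subset)
        show "\<N> \<subseteq> (\<lambda>(\<gamma>, n). (fst (E \<gamma>), snd (E \<gamma>) n)) ` ({..\<beta>} \<times> (UNIV :: nat set))"
          by (force simp: \<N>_def)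
        show "countable ((\<lambda>(\<gamma>, n). (fst (E \<gamma>), snd (E \<gamma>) n)) ` ({..\<beta>} \<times> (UNIV :: nat set)))"
          using countable_atMost_omega1[of \<beta>] by blast
      qed
      have jU: "?F (j l) = UNIV" for l
      proof -
        have "j l < \<beta>" using \<alpha>0 3 by (auto intro: less_le_trans)
        then show ?thesis using IH[of "j l"] by (simp add: P_def cut_below_def)
      qed
      have wp: "?w \<in> points ?F" by (simp add: w_def empty_in_points)
      have N2: "\<alpha>0 \<le> \<alpha> \<and> \<alpha> \<le> \<beta> \<and> z \<inter> {..<\<alpha>} \<noteq> ?w \<inter> {..<\<alpha>}" if "(\<alpha>, z) \<in> \<N>" for \<alpha> z
        using that by (simp add: \<N>_def)
      have top: "?F \<gamma> = {}" if "\<beta> \<le> \<gamma>" for \<gamma>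
        using that by (simp add: cut_below_def leD)
      have "\<exists>R. closed_below \<beta> R \<and> supported ?F R \<and> ?w \<in> R \<and>
          (\<forall>\<alpha> z x. (\<alpha>, z) \<in> \<N> \<longrightarrow> x \<in> R \<longrightarrow> x \<inter> {..<\<alpha>} \<noteq> z \<inter> {..<\<alpha>})"
        by (rule exists_supported[OF cl top pos wp j \<alpha>0 jU N1 N2])
      then obtain R where R: "closed_below \<beta> R" "supported ?F R" "?w \<in> R"
        "\<And>\<alpha> z x. (\<alpha>, z) \<in> \<N> \<Longrightarrow> x \<in> R \<Longrightarrow> x \<inter> {..<\<alpha>} \<noteq> z \<inter> {..<\<alpha>}"
        by blast
      have "avoids ?F \<beta> R"
        unfolding avoids_def
      proof (intro allI impI R(4))
        fix \<gamma> n x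
        assume "\<gamma> \<le> \<beta> \<and> \<alpha>0 \<le> fst (E \<gamma>) \<and> fst (E \<gamma>) \<le> \<beta> \<and>
          snd (E \<gamma>) n \<inter> {..<fst (E \<gamma>)} \<noteq> ?w \<inter> {..<fst (E \<gamma>)} \<and> x \<in> R"
        then show "(fst (E \<gamma>), snd (E \<gamma>) n) \<in> \<N>" "x \<in> R"
          unfolding \<N>_def by blast+
      qed
      then have "P f \<beta> R" using R 3 \<alpha>0 by (auto simp: P_def)
      then show ?thesis ..
    qed
  qed
  then obtain F where F: "\<And>\<beta>. P F \<beta> (F \<beta>)" by blast
  have cl: "\<And>\<beta>. closed_below \<beta> (F \<beta>)" using F by (simp add: P_def)
  show ?thesis
  proof
    show "closed_below \<beta> (F \<beta>)" "supported (cut_below F \<beta>) (F \<beta>)" for \<beta>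
      using F[of \<beta>] by (simp_all add: P_def)
    show "\<exists>\<beta>\<ge>\<alpha>. x \<subseteq> {..<\<beta>} \<and> x \<in> F \<beta>" if x: "x \<in> points F" "countable x" for x \<alpha>
    proof -
      obtain \<alpha>1 where \<alpha>1: "x \<subseteq> {..<\<alpha>1}"
        using countable_bounded_omega1[OF x(2)] .
      obtain \<beta> where \<beta>: "max \<alpha> (max \<alpha>0 \<alpha>1) \<le> \<beta>" "E \<beta> = (\<alpha>1, \<lambda>_. x)"
        using E[of "\<lambda>_. x" \<alpha>1] \<alpha>1 by blast
      have sub: "x \<subseteq> {..<\<beta>}" using \<alpha>1 \<beta>(1) by (auto intro: less_le_trans)
      then have "x \<inter> {..<\<beta>} = x" by blast
      with points_cut_below(1)[OF cl x(1), of \<beta>] have "x \<in> points (cut_below F \<beta>)" by simp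
      then have "w (cut_below F \<beta>) \<beta> = x" by (simp add: w_def \<beta>(2))
      with F[of \<beta>] \<beta>(1) have "x \<in> F \<beta>" by (simp add: P_def)
      with sub \<beta>(1) show ?thesis by auto
    qed
    show "\<exists>\<beta>\<in>x. \<forall>n. \<beta> \<notin> y n"
      if x: "x \<in> points F" "uncountable x" and y: "\<And>n :: nat. y n \<in> points F" "\<And>n. x \<noteq> y n" for x y
    proof -
      obtain \<alpha> where \<alpha>: "\<alpha>0 \<le> \<alpha>" "\<And>n. x \<inter> {..<\<alpha>} \<noteq> y n \<inter> {..<\<alpha>}"
        using ex_separating_omega1[of x y \<alpha>0] y(2) by metis
      \<comment> \<open>The trace of \<open>x\<close> is listed together with those of the \<open>y n\<close>. Since \<open>x \<in> F \<beta>\<close>, it can only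
          be the trace of the selected point, and then the traces of the \<open>y n\<close> are forbidden.\<close>
      define z where "z = case_nat (x \<inter> {..<\<alpha>}) (\<lambda>n. y n \<inter> {..<\<alpha>})"
      have "z n \<subseteq> {..<\<alpha>}" for n by (cases n) (auto simp: z_def)
      then obtain \<gamma> where \<gamma>: "E \<gamma> = (\<alpha>, z)"
        using E by blast
      obtain \<beta> where \<beta>: "\<beta> \<in> x" "max \<alpha> \<gamma> \<le> \<beta>"
        using uncountable_unbounded_omega1[OF x(2)] .
      let ?w = "w (cut_below F \<beta>) \<beta>"
      have av: "avoids (cut_below F \<beta>) \<beta> (F \<beta>)"
        using F[of \<beta>] \<beta>(2) \<alpha>(1) by (auto simp: P_def)
      have key: "v \<inter> {..<\<alpha>} \<noteq> z n \<inter> {..<\<alpha>}" if "v \<in> F \<beta>" "z n \<inter> {..<\<alpha>} \<noteq> ?w \<inter> {..<\<alpha>}" for v n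
        using av that \<beta>(2) \<alpha>(1) \<gamma> unfolding avoids_def by (metis fst_conv snd_conv max.bounded_iff)
      have "x \<in> F \<beta>" using x(1) \<beta>(1) by (auto simp: points_def)
      with key[of x 0] have w: "?w \<inter> {..<\<alpha>} = x \<inter> {..<\<alpha>}"
        by (auto simp: z_def)
      have "\<beta> \<notin> y n" for n
      proof
        assume "\<beta> \<in> y n"
        then have "y n \<in> F \<beta>" using y(1)[of n] by (auto simp: points_def)
        with key[of "y n" "Suc n"] w \<alpha>(2)[of n] show False
          by (auto simp: z_def)
      qed
      with \<beta>(1) show ?thesis by blast
    qed
  qed
qed

section \<open>Sequences in Sigma-subsets\<close>

text \<open>The Frechet-Urysohn property. The \<open>n\<close>-th term is chosen close to \<open>x\<close> on the first \<open>n\<close>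
  coordinates of the supports of \<open>x\<close> and of all earlier terms. Every coordinate in one of these
  countable supports is eventually taken into account, and at all others the sequence and \<open>x\<close> vanish.\<close>

lemma Sigma_product_convergent_sequence:
  fixes \<phi> :: "'a \<Rightarrow> 'i \<Rightarrow> real"
  assumes cont: "continuous_map K (product_topology (\<lambda>_. euclideanreal) \<Gamma>) \<phi>"
    and T: "T \<subseteq> topspace K" "\<And>t. t \<in> T \<Longrightarrow> \<phi> t \<in> Sigma_product \<Gamma>"
    and x: "x \<in> K closure_of T" "\<phi> x \<in> Sigma_product \<Gamma>"
  obtains s :: "nat \<Rightarrow> 'a" where "range s \<subseteq> T"
    "limitin (product_topology (\<lambda>_. euclideanreal) \<Gamma>) (\<phi> \<circ> s) (\<phi> x) sequentially"
proof -
  define supp where "supp t = {\<gamma>\<in>\<Gamma>. \<phi> t \<gamma> \<noteq> 0}" for t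
  define e where "e t = from_nat_into (supp t)" for t
  have e: "\<exists>k. e t k = \<gamma>" if "t \<in> insert x T" "\<gamma> \<in> supp t" for t \<gamma>
  proof -
    have "countable (supp t)"
      using that(1) T(2) x(2) by (auto simp: supp_def Sigma_product_def)
    then show ?thesis
      unfolding e_def using from_nat_into_surj[OF _ that(2)] by blast
  qed
  have near: "\<exists>t\<in>T. \<forall>\<gamma>\<in>A. \<bar>\<phi> t \<gamma> - \<phi> x \<gamma>\<bar> < r" if A: "finite A" "A \<subseteq> \<Gamma>" and r: "r > 0" for A r
  proof -
    define U where "U = {t \<in> topspace K. \<phi> t \<in> PiE \<Gamma> (\<lambda>\<gamma>. if \<gamma> \<in> A then ball (\<phi> x \<gamma>) r else UNIV)}"
    have "openin (product_topology (\<lambda>_. euclideanreal) \<Gamma>)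
        (PiE \<Gamma> (\<lambda>\<gamma>. if \<gamma> \<in> A then ball (\<phi> x \<gamma>) r else UNIV))"
      unfolding openin_PiE_gen using A by (auto intro: finite_subset[of _ A])
    then have "openin K U"
      unfolding U_def by (rule openin_continuous_map_preimage[OF cont])
    moreover have "x \<in> U"
      using x r by (auto simp: U_def Sigma_product_def in_closure_of PiE_iff)
    ultimately obtain t where "t \<in> T" "t \<in> U"
      using x(1) by (auto simp: in_closure_of)
    then show ?thesis
      using A by (intro bexI[of _ t]) (auto simp: U_def PiE_iff dist_real_def abs_minus_commute split: if_splits)
  qed
  define A where "A f n = \<Gamma> \<inter> (\<lambda>(t, k). e t k) ` (insert x (f ` {..<n}) \<times> {..n})" for f and n :: nat
  define P where "P f n t \<longleftrightarrow> t \<in> T \<and> (\<forall>\<gamma>\<in>A f n. \<bar>\<phi> t \<gamma> - \<phi> x \<gamma>\<bar> < 1 / Suc n)" for f n t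
  have "\<exists>s. \<forall>n. P s n (s n)"
  proof (rule dependent_wellorder_choice)
    fix t and f g :: "nat \<Rightarrow> 'a" and n
    assume "\<And>m. m < n \<Longrightarrow> f m = g m"
    then have "f ` {..<n} = g ` {..<n}" by (intro image_cong) auto
    then show "P f n t = P g n t" by (simp add: P_def A_def)
  next
    fix n and f :: "nat \<Rightarrow> 'a"
    have "finite (A f n)" "A f n \<subseteq> \<Gamma>" by (auto simp: A_def)
    from near[OF this, of "1 / Suc n"] show "\<exists>t. P f n t" by (auto simp: P_def)
  qed
  then obtain s where s: "\<And>n. s n \<in> T" "\<And>n \<gamma>. \<gamma> \<in> A s n \<Longrightarrow> \<bar>\<phi> (s n) \<gamma> - \<phi> x \<gamma>\<bar> < 1 / Suc n"
    unfolding P_def by blast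
  have img: "\<phi> t \<in> \<Gamma> \<rightarrow>\<^sub>E UNIV" if "t \<in> insert x T" for t
    using that T(2) x(2) by (auto simp: Sigma_product_def)
  have lim: "(\<lambda>n. \<phi> (s n) \<gamma>) \<longlonglongrightarrow> \<phi> x \<gamma>" if \<gamma>: "\<gamma> \<in> \<Gamma>" for \<gamma>
  proof (cases "\<exists>t\<in>insert x (range s). \<gamma> \<in> supp t")
    case True
    then obtain t where t: "t \<in> insert x (range s)" "\<gamma> \<in> supp t" by blast
    then have "t \<in> insert x T" using s(1) by auto
    then obtain k where k: "e t k = \<gamma>" using e t(2) by blast
    obtain m where m: "t \<in> insert x (s ` {..<m})" using t(1) by (auto intro: that[of "Suc _"])
    have "\<bar>\<phi> (s n) \<gamma> - \<phi> x \<gamma>\<bar> < 1 / Suc n" if n: "n \<ge> max m k" for n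
    proof (rule s(2))
      have "t \<in> insert x (s ` {..<n})" using m n by auto
      then have "(t, k) \<in> insert x (s ` {..<n}) \<times> {..n}" using n by auto
      then show "\<gamma> \<in> A s n" unfolding A_def using \<gamma> k by force
    qed
    then have "\<forall>\<^sub>F n in sequentially. norm (\<phi> (s n) \<gamma> - \<phi> x \<gamma>) \<le> 1 / Suc n"
      by (auto simp: eventually_sequentially intro!: exI[of _ "max m k"] less_imp_le)
    then have "(\<lambda>n. \<phi> (s n) \<gamma> - \<phi> x \<gamma>) \<longlonglongrightarrow> 0"
      by (rule Lim_null_comparison) (use LIMSEQ_inverse_real_of_nat in \<open>simp add: inverse_eq_divide\<close>)
    then show ?thesis by (simp add: LIM_zero_iff)
  next
    case False
    then have "\<phi> (s n) \<gamma> = \<phi> x \<gamma>" for n using \<gamma> by (auto simp: supp_def)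
    then show ?thesis by simp
  qed
  show ?thesis
  proof
    show "range s \<subseteq> T" using s(1) by blast
    show "limitin (product_topology (\<lambda>_. euclideanreal) \<Gamma>) (\<phi> \<circ> s) (\<phi> x) sequentially"
      unfolding limitin_componentwise using img s(1) lim
      by (auto simp: PiE_iff intro!: always_eventually)
  qed
qed

lemma sigma_subset_subset: "sigma_subset K S \<Longrightarrow> S \<subseteq> topspace K"
  by (auto simp: sigma_subset_def)

lemma sigma_subset_Frechet:
  assumes K: "compact_space K" and S: "sigma_subset K S"
    and T: "T \<subseteq> S" and x: "x \<in> S" "x \<in> K closure_of T"
  obtains s :: "nat \<Rightarrow> 'a" where "range s \<subseteq> T" "limitin K s x sequentially"
proof -
  obtain \<Gamma> :: "('a \<Rightarrow> real) set" and \<phi>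
    where cont: "continuous_map K (product_topology (\<lambda>_. euclideanreal) \<Gamma>) \<phi>"
      and inj: "inj_on \<phi> (topspace K)"
      and S_eq: "S = {x \<in> topspace K. \<phi> x \<in> Sigma_product \<Gamma>}"
    using S unfolding sigma_subset_def by blast
  let ?Y = "product_topology (\<lambda>_. euclideanreal) \<Gamma>"
  have H: "Hausdorff_space ?Y" by (simp add: Hausdorff_space_product_topology)
  obtain s where s: "range s \<subseteq> T" "limitin ?Y (\<phi> \<circ> s) (\<phi> x) sequentially"
    using Sigma_product_convergent_sequence[OF cont, of T x] T x S_eq by blast
  have "homeomorphic_map K (subtopology ?Y (\<phi> ` topspace K)) \<phi>"
    using continuous_imp_embedding_map[OF cont K H inj] unfolding embedding_map_def .
  then obtain g where g: "homeomorphic_maps K (subtopology ?Y (\<phi> ` topspace K)) \<phi> g"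
    unfolding homeomorphic_map_maps by blast
  then have gc: "continuous_map (subtopology ?Y (\<phi> ` topspace K)) K g"
    and gf: "\<And>y. y \<in> topspace K \<Longrightarrow> g (\<phi> y) = y"
    by (auto simp: homeomorphic_maps_def)
  have in_K: "s n \<in> topspace K" "x \<in> topspace K" for n
    using s(1) T x(1) S_eq by auto
  have "limitin (subtopology ?Y (\<phi> ` topspace K)) (\<phi> \<circ> s) (\<phi> x) sequentially"
    using s(2) in_K by (auto simp: limitin_subtopology intro!: always_eventually)
  from continuous_map_limit[OF gc this] have "limitin K (g \<circ> (\<phi> \<circ> s)) (g (\<phi> x)) sequentially" .
  also have "g \<circ> (\<phi> \<circ> s) = s" using gf in_K by (auto simp: fun_eq_iff)
  finally have "limitin K s x sequentially" using gf in_K by simp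
  with s(1) show ?thesis by (rule that)
qed

text \<open>The support of a limit is contained in the union of countably many countable supports.\<close>

lemma sigma_subset_limit:
  assumes S: "sigma_subset K S" and s: "range s \<subseteq> S" "limitin K s x sequentially"
  shows "x \<in> S"
proof -
  obtain \<Gamma> :: "('a \<Rightarrow> real) set" and \<phi>
    where cont: "continuous_map K (product_topology (\<lambda>_. euclideanreal) \<Gamma>) \<phi>"
      and S_eq: "S = {x \<in> topspace K. \<phi> x \<in> Sigma_product \<Gamma>}"
    using S unfolding sigma_subset_def by blast
  have x: "x \<in> topspace K" using s(2) by (auto dest: limitin_topspace)
  have *: "\<phi> x \<in> extensional \<Gamma>" "\<And>\<gamma>. \<gamma> \<in> \<Gamma> \<Longrightarrow> (\<lambda>n. \<phi> (s n) \<gamma>) \<longlonglongrightarrow> \<phi> x \<gamma>"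
    using continuous_map_limit[OF cont s(2)] by (auto simp: limitin_componentwise)
  have "countable {\<gamma>\<in>\<Gamma>. \<phi> x \<gamma> \<noteq> 0}"
  proof (rule countable_subset)
    show "{\<gamma>\<in>\<Gamma>. \<phi> x \<gamma> \<noteq> 0} \<subseteq> (\<Union>n. {\<gamma>\<in>\<Gamma>. \<phi> (s n) \<gamma> \<noteq> 0})"
    proof (rule ccontr)
      assume "\<not> ?thesis"
      then obtain \<gamma> where \<gamma>: "\<gamma> \<in> \<Gamma>" "\<phi> x \<gamma> \<noteq> 0" "\<And>n. \<phi> (s n) \<gamma> = 0" by blast
      with *(2)[OF \<gamma>(1)] show False by (simp add: LIMSEQ_const_iff)
    qed
    show "countable (\<Union>n. {\<gamma>\<in>\<Gamma>. \<phi> (s n) \<gamma> \<noteq> 0})"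
      using s(1) by (auto simp: S_eq Sigma_product_def)
  qed
  with x * show ?thesis by (simp add: S_eq Sigma_product_def PiE_def)
qed

lemma countable_base_imp_gdelta:
  assumes "is_base K \<B>" "countable \<B>" "Hausdorff_space K" "x \<in> topspace K"
  shows "gdelta_in K {x}"
proof -
  let ?\<T> = "{V\<in>\<B>. x \<in> V}"
  have base: "\<And>V. V \<in> \<B> \<Longrightarrow> openin K V"
    "\<And>U y. openin K U \<Longrightarrow> y \<in> U \<Longrightarrow> \<exists>V\<in>\<B>. y \<in> V \<and> V \<subseteq> U"
    using assms(1) unfolding is_base_def by blast+
  have "\<Inter>?\<T> = {x}"
  proof
    obtain V0 where V0: "V0 \<in> \<B>" "x \<in> V0"
      using base(2)[OF openin_topspace assms(4)] by blast
    show "\<Inter>?\<T> \<subseteq> {x}"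
    proof
      fix y assume y: "y \<in> \<Inter>?\<T>"
      then have "y \<in> V0" using V0 by blast
      then have "y \<in> topspace K" using base(1)[OF V0(1)] openin_subset by blast
      have "y = x"
      proof (rule ccontr)
        assume "y \<noteq> x"
        then obtain U W where "openin K U" "x \<in> U" "openin K W" "y \<in> W" "disjnt U W"
          using assms(3,4) \<open>y \<in> topspace K\<close> unfolding Hausdorff_space_def by metis
        then obtain V where "V \<in> \<B>" "x \<in> V" "V \<subseteq> U" using base(2) by blast
        with y \<open>y \<in> W\<close> \<open>disjnt U W\<close> show False by (auto simp: disjnt_def)
      qed
      then show "y \<in> {x}" by simp
    qed
  qed auto
  moreover have "(countable intersection_of openin K) (\<Inter>?\<T>)"
    unfolding intersection_of_def using assms(2) base(1) by (intro exI[of _ ?\<T>]) auto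
  ultimately show ?thesis using assms(4) by (simp add: gdelta_in_alt)
qed

section \<open>The compact space of a system\<close>

definition char_fun :: "omega1 set \<Rightarrow> omega1 \<Rightarrow> real" where
  "char_fun x = (\<lambda>\<beta>. if \<beta> \<in> x then 1 else 0)"

definition cantor_subspace :: "omega1 set set \<Rightarrow> (omega1 \<Rightarrow> real) topology" where
  "cantor_subspace P = subtopology (product_topology (\<lambda>_. euclideanreal) UNIV) (char_fun ` P)"

lemma inj_char_fun: "inj char_fun"
  by (rule injI) (auto simp: char_fun_def fun_eq_iff split: if_splits)

lemma char_fun_in_iff [simp]: "char_fun x \<in> char_fun ` P \<longleftrightarrow> x \<in> P"
  by (rule inj_image_mem_iff[OF inj_char_fun])

lemma topspace_cantor [simp]: "topspace (cantor_subspace P) = char_fun ` P"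
  by (auto simp: cantor_subspace_def)

lemma openin_cantor_cylinder:
  assumes "finite A"
  shows "openin (cantor_subspace P) (char_fun ` {y\<in>P. y \<inter> A = B})"
proof (cases "B \<subseteq> A")
  case True
  let ?V = "\<lambda>\<beta>. if \<beta> \<in> A then (if \<beta> \<in> B then {1/2<..} else {..<1/2}) else (UNIV :: real set)"
  have "openin (product_topology (\<lambda>_. euclideanreal) UNIV) (PiE UNIV ?V)"
    unfolding openin_PiE_gen using assms by (auto intro!: disjI2 intro: finite_subset[of _ A])
  moreover have "char_fun y \<in> PiE UNIV ?V \<longleftrightarrow> y \<inter> A = B" for y
    using True by (auto simp: PiE_iff char_fun_def split: if_splits)
  then have "char_fun ` {y\<in>P. y \<inter> A = B} = PiE UNIV ?V \<inter> char_fun ` P"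
    by blast
  ultimately show ?thesis
    unfolding cantor_subspace_def openin_subtopology by blast
next
  case False
  then have "{y\<in>P. y \<inter> A = B} = {}" by auto
  then show ?thesis by (simp only: image_empty openin_empty)
qed

lemma openin_cantor_nbhd:
  assumes "openin (cantor_subspace P) U" "char_fun x \<in> U"
  obtains A where "finite A" "char_fun ` {y\<in>P. y \<inter> A = x \<inter> A} \<subseteq> U"
proof -
  obtain T where T: "openin (product_topology (\<lambda>_. euclideanreal) UNIV) T" "U = T \<inter> char_fun ` P"
    using assms(1) unfolding cantor_subspace_def openin_subtopology by blast
  with assms(2) obtain V where V: "finite {\<beta>. V \<beta> \<noteq> (UNIV :: real set)}"
    "char_fun x \<in> PiE UNIV V" "PiE UNIV V \<subseteq> T"
    unfolding openin_product_topology_alt by auto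
  have "char_fun y \<in> PiE UNIV V" if "y \<inter> {\<beta>. V \<beta> \<noteq> UNIV} = x \<inter> {\<beta>. V \<beta> \<noteq> UNIV}" for y
  proof -
    have "char_fun y \<beta> \<in> V \<beta>" for \<beta>
    proof (cases "V \<beta> = UNIV")
      case False
      then have "char_fun y \<beta> = char_fun x \<beta>" using that by (auto simp: char_fun_def)
      then show ?thesis using V(2) by (auto simp: PiE_iff)
    qed simp
    then show ?thesis by (auto simp: PiE_iff)
  qed
  with V(3) T(2) show ?thesis
    by (intro that[OF V(1)]) blast
qed

lemma Hausdorff_cantor: "Hausdorff_space (cantor_subspace P)"
  unfolding cantor_subspace_def by (simp add: Hausdorff_space_subtopology Hausdorff_space_product_topology)

lemma compact_cantor_UNIV: "compact_space (cantor_subspace UNIV)"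
proof -
  have "range char_fun = PiE UNIV (\<lambda>_. {0, 1})"
  proof
    show "range char_fun \<subseteq> PiE UNIV (\<lambda>_. {0, 1})" by (auto simp: char_fun_def split: if_splits)
    show "PiE UNIV (\<lambda>_. {0, 1}) \<subseteq> range char_fun"
    proof
      fix f :: "omega1 \<Rightarrow> real" assume "f \<in> PiE UNIV (\<lambda>_. {0, 1})"
      then have "f \<beta> = 0 \<or> f \<beta> = 1" for \<beta> by (auto simp: PiE_iff)
      then have "f = char_fun {\<beta>. f \<beta> = 1}" by (auto simp: char_fun_def fun_eq_iff)
      then show "f \<in> range char_fun" by blast
    qed
  qed
  then have "cantor_subspace UNIV = product_topology (\<lambda>_. subtopology euclideanreal {0, 1}) UNIV"
    unfolding cantor_subspace_def by (simp add: subtopology_product_topology)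
  moreover have "compact_space (subtopology euclideanreal {0, 1})"
    by (simp add: compact_space_subtopology)
  ultimately show ?thesis by (simp add: compact_space_product_topology)
qed

text \<open>If \<open>x\<close> is not a point, then \<open>x \<notin> F \<beta>\<close> for some \<open>\<beta> \<in> x\<close>, which is decided by finitely many
  coordinates of \<open>x\<close>.\<close>

lemma compact_cantor_points:
  assumes cl: "\<And>\<gamma>. closed_below \<gamma> (F \<gamma>)"
  shows "compact_space (cantor_subspace (points F))"
proof -
  have "openin (cantor_subspace UNIV) (char_fun ` (- points F))"
  proof (subst openin_subopen, intro ballI)
    fix f assume "f \<in> char_fun ` (- points F)"
    then obtain x where x: "x \<notin> points F" "f = char_fun x" by auto
    then obtain \<beta> where \<beta>: "\<beta> \<in> x" "x \<notin> F \<beta>" by (auto simp: points_def)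
    obtain \<G> where \<G>: "\<forall>(A, B)\<in>\<G>. finite A \<and> A \<subseteq> {..<\<beta>} \<and> B \<subseteq> A"
      and R: "F \<beta> = {x. \<forall>(A, B)\<in>\<G>. x \<inter> A \<noteq> B}"
      using cl[of \<beta>] unfolding closed_below_def by blast
    obtain A where A: "(A, x \<inter> A) \<in> \<G>" using \<beta>(2) unfolding R by auto
    let ?U = "char_fun ` {y\<in>UNIV. y \<inter> insert \<beta> A = x \<inter> insert \<beta> A}"
    have "y \<notin> points F" if "y \<inter> insert \<beta> A = x \<inter> insert \<beta> A" for y
    proof -
      have "\<beta> \<in> y" "y \<inter> A = x \<inter> A" using that \<beta>(1) by blast+
      moreover from this(2) have "y \<notin> F \<beta>" using A unfolding R by auto
      ultimately show ?thesis by (auto simp: points_def)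
    qed
    then have "?U \<subseteq> char_fun ` (- points F)" by blast
    moreover have "openin (cantor_subspace UNIV) ?U"
      using \<G> A by (intro openin_cantor_cylinder) auto
    ultimately show "\<exists>T. openin (cantor_subspace UNIV) T \<and> f \<in> T \<and> T \<subseteq> char_fun ` (- points F)"
      using x(2) by blast
  qed
  then have "closedin (cantor_subspace UNIV) (topspace (cantor_subspace UNIV) - char_fun ` (- points F))"
    by (rule closedin_diff[OF closedin_topspace])
  also have "topspace (cantor_subspace UNIV) - char_fun ` (- points F) = char_fun ` points F"
    unfolding topspace_cantor image_set_diff[OF inj_char_fun, symmetric] by simp
  finally have "compactin (cantor_subspace UNIV) (char_fun ` points F)"
    by (rule closedin_compact_space[OF compact_cantor_UNIV])
  then have "compact_space (subtopology (cantor_subspace UNIV) (char_fun ` points F))"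
    by (rule compact_space_subtopology)
  also have "subtopology (cantor_subspace UNIV) (char_fun ` points F) = cantor_subspace (points F)"
    unfolding cantor_subspace_def subtopology_subtopology by (simp add: image_mono Int_absorb1)
  finally show ?thesis .
qed

text \<open>A basic neighbourhood of \<open>x\<close> contains the traces of \<open>x\<close> on all sufficiently large \<open>\<alpha>\<close>.\<close>

lemma dense_sigma_subset_countable_points:
  assumes cl: "\<And>\<gamma>. closed_below \<gamma> (F \<gamma>)"
  shows "dense_sigma_subset (cantor_subspace (points F)) (char_fun ` {x\<in>points F. countable x})"
  unfolding dense_sigma_subset_def
proof
  let ?K = "cantor_subspace (points F)"
  have "continuous_map ?K (product_topology (\<lambda>_. euclideanreal) UNIV) (\<lambda>f. f)"
    unfolding cantor_subspace_def by (intro continuous_map_from_subtopology continuous_map_id[unfolded id_def])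
  then have "sigma_subset ?K {f \<in> topspace ?K. f \<in> Sigma_product UNIV}"
    by (rule sigma_subsetI) simp
  also have "{f \<in> topspace ?K. f \<in> Sigma_product UNIV} = char_fun ` {x\<in>points F. countable x}"
  proof -
    have "{\<gamma>\<in>UNIV. char_fun x \<gamma> \<noteq> 0} = x" for x
      by (simp add: char_fun_def)
    then have "char_fun x \<in> Sigma_product UNIV \<longleftrightarrow> countable x" for x
      by (simp add: Sigma_product_def)
    then show ?thesis unfolding topspace_cantor by blast
  qed
  finally show "sigma_subset ?K (char_fun ` {x\<in>points F. countable x})" .
  show "?K closure_of char_fun ` {x\<in>points F. countable x} = topspace ?K"
  proof (intro equalityI closure_of_subset_topspace subsetI)
    fix f assume "f \<in> topspace ?K"
    then obtain x where x: "x \<in> points F" "f = char_fun x" by auto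
    have "\<exists>y. y \<in> char_fun ` {x\<in>points F. countable x} \<and> y \<in> U" if U: "openin ?K U" "f \<in> U" for U
    proof -
      have "char_fun x \<in> U" using U(2) x(2) by simp
      then obtain A where A: "finite A" "char_fun ` {y\<in>points F. y \<inter> A = x \<inter> A} \<subseteq> U"
        by (rule openin_cantor_nbhd[OF U(1)])
      obtain \<alpha> where \<alpha>: "A \<subseteq> {..<\<alpha>}"
        using countable_bounded_omega1[OF countable_finite[OF A(1)]] .
      have "x \<inter> {..<\<alpha>} \<in> points F" by (rule points_restrict[OF cl x(1)])
      moreover have "x \<inter> {..<\<alpha>} \<inter> A = x \<inter> A" using \<alpha> by blast
      moreover have "countable (x \<inter> {..<\<alpha>})"
        by (intro countable_Int2 countable_lessThan_omega1)
      ultimately show ?thesis using A(2) by blast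
    qed
    with x show "f \<in> ?K closure_of char_fun ` {x\<in>points F. countable x}"
      by (auto simp: in_closure_of)
  qed
qed

text \<open>Disjoint open sets correspond to disjoint events of positive probability, and their probabilities
  have sum at most \<open>1\<close>.\<close>

lemma ccc_cantor_points:
  assumes cl: "\<And>\<gamma>. closed_below \<gamma> (F \<gamma>)" and pos: "supported F UNIV"
  shows "ccc_space (cantor_subspace (points F))"
  unfolding ccc_space_def
proof (intro allI impI, elim conjE)
  fix \<U> assume U: "\<forall>U\<in>\<U>. openin (cantor_subspace (points F)) U \<and> U \<noteq> {}" and disj: "pairwise disjnt \<U>"
  have "\<exists>E. E \<in> sets coins \<and> measure coins E > 0 \<and> (\<forall>\<epsilon>\<in>E. char_fun (random_point F \<epsilon>) \<in> U)"
    if "U \<in> \<U>" for U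
  proof -
    have op: "openin (cantor_subspace (points F)) U" using U that by blast
    have "U \<noteq> {}" using U that by simp
    then obtain f where f: "f \<in> U" by blast
    then have "f \<in> char_fun ` points F" using openin_subset[OF op] by auto
    with f obtain x where x: "x \<in> points F" "char_fun x \<in> U" by blast
    obtain A where A: "finite A" "char_fun ` {y\<in>points F. y \<inter> A = x \<inter> A} \<subseteq> U"
      using openin_cantor_nbhd[OF op x(2)] .
    show ?thesis
    proof (intro exI[of _ "{\<epsilon>. random_point F \<epsilon> \<inter> A = x \<inter> A}"] conjI ballI)
      show "{\<epsilon>. random_point F \<epsilon> \<inter> A = x \<inter> A} \<in> sets coins"
        by (intro measurable_random_point_Int measurable_random_point cl A)
      show "measure coins {\<epsilon>. random_point F \<epsilon> \<inter> A = x \<inter> A} > 0"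
        using pos A(1) x(1) by (simp add: supported_def)
      show "char_fun (random_point F \<epsilon>) \<in> U" if "\<epsilon> \<in> {\<epsilon>. random_point F \<epsilon> \<inter> A = x \<inter> A}" for \<epsilon>
        using that A(2) random_point_in_points[OF cl, of \<epsilon>] by blast
    qed
  qed
  then obtain E where E: "\<And>U. U \<in> \<U> \<Longrightarrow> E U \<in> sets coins" "\<And>U. U \<in> \<U> \<Longrightarrow> measure coins (E U) > 0"
    "\<And>U \<epsilon>. U \<in> \<U> \<Longrightarrow> \<epsilon> \<in> E U \<Longrightarrow> char_fun (random_point F \<epsilon>) \<in> U"
    by metis
  have "(\<lambda>U. measure coins (E U)) summable_on \<U>"
  proof (rule nonneg_bdd_above_summable_on)
    have "sum (\<lambda>U. measure coins (E U)) \<V> \<le> 1" if "\<V> \<subseteq> \<U>" "finite \<V>" for \<V>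
    proof -
      have "disjoint_family_on E \<V>"
        unfolding disjoint_family_on_def
      proof (intro ballI impI)
        fix U V assume "U \<in> \<V>" "V \<in> \<V>" "U \<noteq> V"
        then have "U \<inter> V = {}" "U \<in> \<U>" "V \<in> \<U>"
          using disj that by (auto simp: pairwise_def disjnt_def)
        then show "E U \<inter> E V = {}" using E(3) by blast
      qed
      then have "sum (\<lambda>U. measure coins (E U)) \<V> = measure coins (\<Union>U\<in>\<V>. E U)"
        using that E(1) by (intro coins.finite_measure_finite_Union[symmetric]) auto
      then show ?thesis by simp
    qed
    then show "bdd_above (sum (\<lambda>U. measure coins (E U)) ` {\<V>. \<V> \<subseteq> \<U> \<and> finite \<V>})"
      by (auto intro!: bdd_aboveI[of _ 1])
  qed simp
  then have "countable {U\<in>\<U>. measure coins (E U) \<noteq> 0}"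
    by (rule summable_countable_real)
  also have "{U\<in>\<U>. measure coins (E U) \<noteq> 0} = \<U>" using E(2) by force
  finally show "countable \<U>" .
qed

text \<open>If \<open>{x}\<close> is a \<open>G\<^sub>\<delta>\<close> set, then \<open>x\<close> is the only point with its trace on some \<open>\<alpha>\<close>. So \<open>x\<close> equals this
  trace and is countable, and it has a second extension \<open>insert \<beta> x\<close> with the same trace.\<close>

lemma cantor_points_not_gdelta:
  assumes cl: "\<And>\<gamma>. closed_below \<gamma> (F \<gamma>)"
    and ext: "\<And>x \<alpha>. x \<in> points F \<Longrightarrow> countable x \<Longrightarrow> \<exists>\<beta>\<ge>\<alpha>. x \<subseteq> {..<\<beta>} \<and> x \<in> F \<beta>"
    and f: "f \<in> topspace (cantor_subspace (points F))"
  shows "\<not> gdelta_in (cantor_subspace (points F)) {f}"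
proof
  let ?K = "cantor_subspace (points F)"
  assume "gdelta_in ?K {f}"
  then obtain \<T> where \<T>: "countable \<T>" "\<And>T. T \<in> \<T> \<Longrightarrow> openin ?K T" "\<Inter>\<T> = {f}"
    unfolding gdelta_in_alt intersection_of_def by auto
  obtain x where x: "x \<in> points F" "f = char_fun x" using f by auto
  have "\<forall>T\<in>\<T>. \<exists>A. finite A \<and> char_fun ` {y\<in>points F. y \<inter> A = x \<inter> A} \<subseteq> T"
  proof
    fix T assume T: "T \<in> \<T>"
    have "f \<in> \<Inter>\<T>" unfolding \<T>(3) by simp
    then have "char_fun x \<in> T" using T x(2) by blast
    obtain A where "finite A" "char_fun ` {y\<in>points F. y \<inter> A = x \<inter> A} \<subseteq> T"
      by (rule openin_cantor_nbhd[OF \<T>(2)[OF T] \<open>char_fun x \<in> T\<close>])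
    then show "\<exists>A. finite A \<and> char_fun ` {y\<in>points F. y \<inter> A = x \<inter> A} \<subseteq> T" by (intro exI conjI)
  qed
  from bchoice[OF this] obtain A
    where "\<forall>T\<in>\<T>. finite (A T) \<and> char_fun ` {y\<in>points F. y \<inter> A T = x \<inter> A T} \<subseteq> T" ..
  then have A: "finite (A T)" "char_fun ` {y\<in>points F. y \<inter> A T = x \<inter> A T} \<subseteq> T" if "T \<in> \<T>" for T
    using that by auto
  have "countable (\<Union>T\<in>\<T>. A T)"
    by (intro countable_UN \<T>(1) countable_finite A(1))
  then obtain \<alpha> where \<alpha>: "(\<Union>T\<in>\<T>. A T) \<subseteq> {..<\<alpha>}"
    by (rule countable_bounded_omega1)
  have unique: "y = x" if y: "y \<in> points F" "y \<inter> {..<\<alpha>} = x \<inter> {..<\<alpha>}" for y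
  proof -
    have "char_fun y \<in> T" if T: "T \<in> \<T>" for T
    proof -
      have "y \<inter> A T = x \<inter> A T" using y(2) \<alpha> T by blast
      then show ?thesis using A(2)[OF T] y(1) by blast
    qed
    then have "char_fun y \<in> \<Inter>\<T>" by blast
    then show ?thesis using \<T>(3) x(2) inj_char_fun by (auto dest: injD)
  qed
  let ?x = "x \<inter> {..<\<alpha>}"
  have px: "?x \<in> points F" by (rule points_restrict[OF cl x(1)])
  then have "?x = x" by (rule unique) simp
  moreover have "countable ?x" by (intro countable_Int2 countable_lessThan_omega1)
  ultimately obtain \<beta> where \<beta>: "\<alpha> \<le> \<beta>" "x \<subseteq> {..<\<beta>}" "x \<in> F \<beta>"
    using ext[OF px, of \<alpha>] by auto
  have "insert \<beta> x \<in> points F"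
    unfolding points_def
  proof clarify
    fix \<gamma> assume "\<gamma> \<in> insert \<beta> x"
    then have "\<gamma> \<le> \<beta>" "x \<in> F \<gamma>" using \<beta> x(1) by (auto simp: points_def)
    moreover have "insert \<beta> x \<inter> {..<\<gamma>} = x \<inter> {..<\<gamma>}" using \<open>\<gamma> \<le> \<beta>\<close> by auto
    ultimately show "insert \<beta> x \<in> F \<gamma>" using closed_below_cong[OF cl] by blast
  qed
  moreover have "insert \<beta> x \<inter> {..<\<alpha>} = x \<inter> {..<\<alpha>}" using \<beta>(1) by auto
  ultimately have "insert \<beta> x = x" by (rule unique)
  then show False using \<beta>(2) by auto
qed

text \<open>The cylinders form a base of size \<open>\<omega>\<^sub>1\<close>, since only countably many of them live below a given
  \<open>\<alpha>\<close>. A countable base would make every point a \<open>G\<^sub>\<delta>\<close> point.\<close>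

lemma weight_cantor_points:
  assumes nG: "\<And>f. f \<in> topspace (cantor_subspace P) \<Longrightarrow> \<not> gdelta_in (cantor_subspace P) {f}" and ne: "P \<noteq> {}"
  shows "weight (cantor_subspace P) =o card_suc natLeq"
proof -
  obtain \<B> where \<B>: "is_base (cantor_subspace P) \<B>" "weight (cantor_subspace P) = |\<B>|"
    "\<And>\<B>'. is_base (cantor_subspace P) \<B>' \<Longrightarrow> |\<B>| \<le>o |\<B>'|"
    by (rule weight_minimal) blast
  define C where "C \<alpha> = (\<lambda>(A, B). char_fun ` {y\<in>P. y \<inter> A = B}) ` {(A, B). finite A \<and> A \<subseteq> {..<\<alpha>} \<and> B \<subseteq> A}"
    for \<alpha> :: omega1
  have "is_base (cantor_subspace P) (\<Union>\<alpha>. C \<alpha>)"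
    unfolding is_base_def
  proof (intro conjI ballI allI impI)
    fix V assume "V \<in> (\<Union>\<alpha>. C \<alpha>)"
    then show "openin (cantor_subspace P) V" by (auto simp: C_def intro: openin_cantor_cylinder)
  next
  fix U f assume "openin (cantor_subspace P) U \<and> f \<in> U"
    then have U: "openin (cantor_subspace P) U" "f \<in> U" by auto
    then have "f \<in> topspace (cantor_subspace P)" using openin_subset by blast
    then obtain x where x: "x \<in> P" "f = char_fun x" by auto
    have "char_fun x \<in> U" using U(2) x(2) by simp
    then obtain A where A: "finite A" "char_fun ` {y\<in>P. y \<inter> A = x \<inter> A} \<subseteq> U"
      by (rule openin_cantor_nbhd[OF U(1)])
    obtain \<alpha> where "A \<subseteq> {..<\<alpha>}"
      using countable_bounded_omega1[OF countable_finite[OF A(1)]] .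
    then have "char_fun ` {y\<in>P. y \<inter> A = x \<inter> A} \<in> C \<alpha>"
      unfolding C_def using A(1) by (intro image_eqI[of _ _ "(A, x \<inter> A)"]) auto
    moreover have "f \<in> char_fun ` {y\<in>P. y \<inter> A = x \<inter> A}" using x by simp
    ultimately show "\<exists>V\<in>\<Union>\<alpha>. C \<alpha>. f \<in> V \<and> V \<subseteq> U"
      using A(2) by (intro bexI[of _ "char_fun ` {y\<in>P. y \<inter> A = x \<inter> A}"]) auto
  qed
  then have "|\<B>| \<le>o |\<Union>\<alpha>. C \<alpha>|" by (rule \<B>(3))
  moreover have "|\<Union>\<alpha>. C \<alpha>| \<le>o |UNIV :: omega1 set|"
  proof (rule card_of_UNION_ordLeq_infinite)
    show inf: "infinite (UNIV :: omega1 set)"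
      using uncountable_omega1 countable_finite by blast
    show "|UNIV :: omega1 set| \<le>o |UNIV :: omega1 set|" by (rule card_of_mono1[OF subset_refl])
    have "|C \<alpha>| \<le>o |UNIV :: omega1 set|" for \<alpha>
    proof -
      have "countable (C \<alpha>)" unfolding C_def by (intro countable_image countable_conditions)
      then have "|C \<alpha>| \<le>o |UNIV :: nat set|" by (simp add: countable_card_of_nat)
      also have "|UNIV :: nat set| \<le>o |UNIV :: omega1 set|"
        using inf by (simp add: infinite_iff_card_of_nat)
      finally show ?thesis .
    qed
    then show "\<forall>\<alpha>\<in>UNIV. |C \<alpha>| \<le>o |UNIV :: omega1 set|" by simp
  qed
  ultimately have "|\<B>| \<le>o |UNIV :: omega1 set|" by (rule ordLeq_transitive)
  then have upper: "|\<B>| \<le>o card_suc natLeq"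
    using card_omega1 by (rule ordLeq_ordIso_trans)
  obtain x where "x \<in> P" using ne by blast
  then have "uncountable \<B>"
    using countable_base_imp_gdelta[OF \<B>(1) _ Hausdorff_cantor, of "char_fun x"] nG[of "char_fun x"] by auto
  then have "natLeq <o |\<B>|"
    by (simp add: countable_card_le_natLeq not_ordLeq_iff_ordLess[OF natLeq_Well_order card_of_Well_order])
  then have "card_suc natLeq \<le>o |\<B>|"
    by (intro card_suc_least natLeq_card_order card_of_Card_order)
  with upper show ?thesis unfolding \<B>(2) by (simp add: ordIso_iff_ordLeq)
qed

section \<open>Convergent sequences\<close>

text \<open>Otherwise some coordinate \<open>\<beta> \<in> x\<close> separates \<open>x\<close> from all terms of a subsequence.\<close>

lemma convergent_to_uncountable_point:
  assumes seq: "\<And>x y. x \<in> points F \<Longrightarrow> uncountable x \<Longrightarrow> (\<And>n :: nat. y n \<in> points F) \<Longrightarrow>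
      (\<And>n. x \<noteq> y n) \<Longrightarrow> \<exists>\<beta>\<in>x. \<forall>n. \<beta> \<notin> y n"
    and x: "x \<in> points F" "uncountable x"
    and s: "range s \<subseteq> topspace (cantor_subspace (points F))" "limitin (cantor_subspace (points F)) s (char_fun x) sequentially"
  shows "\<forall>\<^sub>F n in sequentially. s n = char_fun x"
proof (rule ccontr)
  assume "\<not> ?thesis"
  then have "infinite {n. s n \<noteq> char_fun x}"
    by (simp add: eventually_cofinite cofinite_eq_sequentially[symmetric])
  then obtain r :: "nat \<Rightarrow> nat" where r: "strict_mono r" "\<And>n. s (r n) \<noteq> char_fun x"
    using infinite_enumerate[of "{n. s n \<noteq> char_fun x}"] by auto
  have "\<exists>y\<in>points F. s n = char_fun y" for n using s(1) by auto
  then obtain y where y: "\<And>n. y n \<in> points F" "\<And>n. s n = char_fun (y n)" by metis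
  have "x \<noteq> y (r n)" for n using r(2)[of n] y(2) by auto
  then obtain \<beta> where \<beta>: "\<beta> \<in> x" "\<And>n. \<beta> \<notin> y (r n)"
    using seq[OF x, of "\<lambda>n. y (r n)"] y(1) by auto
  let ?U = "char_fun ` {z\<in>points F. z \<inter> {\<beta>} = {\<beta>}}"
  have "openin (cantor_subspace (points F)) ?U" by (rule openin_cantor_cylinder) simp
  moreover have "char_fun x \<in> ?U" using x(1) \<beta>(1) by auto
  ultimately have "\<forall>\<^sub>F n in sequentially. s n \<in> ?U"
    using s(2) by (auto simp: limitin_def)
  then obtain N where "\<And>n. n \<ge> N \<Longrightarrow> s n \<in> ?U" by (auto simp: eventually_sequentially)
  then have "s (r N) \<in> ?U" using seq_suble[OF r(1)] by blast
  then have "\<beta> \<in> y (r N)" unfolding y(2) char_fun_in_iff by auto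
  with \<beta>(2) show False by blast
qed

theorem theorem4p1:
  assumes diamond
  shows "\<exists>K :: (omega1 \<Rightarrow> real) topology.
    Valdivia_compact K \<and>
    weight K =o card_suc natLeq \<and>
    ccc_space K \<and>
    (\<forall>x \<in> topspace K. \<not> gdelta_in K {x}) \<and>
    (\<forall>S. dense_sigma_subset K S \<longrightarrow>
       \<not> has_nontrivial_convergent_sequence (subtopology K (topspace K - S)))"
proof -
  obtain F where cl: "\<And>\<beta>. closed_below \<beta> (F \<beta>)" and sup: "\<And>\<beta>. supported (cut_below F \<beta>) (F \<beta>)"
    and ext: "\<And>x \<alpha>. x \<in> points F \<Longrightarrow> countable x \<Longrightarrow> \<exists>\<beta>\<ge>\<alpha>. x \<subseteq> {..<\<beta>} \<and> x \<in> F \<beta>"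
    and seq: "\<And>x y. x \<in> points F \<Longrightarrow> uncountable x \<Longrightarrow> (\<And>n :: nat. y n \<in> points F) \<Longrightarrow>
       (\<And>n. x \<noteq> y n) \<Longrightarrow> \<exists>\<beta>\<in>x. \<forall>n. \<beta> \<notin> y n"
    by (rule exists_system[OF assms]) blast
  let ?K = "cantor_subspace (points F)"
  let ?S0 = "char_fun ` {x\<in>points F. countable x}"
  have compact: "compact_space ?K" by (rule compact_cantor_points[OF cl])
  have S0: "dense_sigma_subset ?K ?S0" by (rule dense_sigma_subset_countable_points[OF cl])
  have nG: "\<not> gdelta_in ?K {f}" if "f \<in> topspace ?K" for f
    by (rule cantor_points_not_gdelta[OF cl ext that])
  have limit: "\<forall>\<^sub>F n in sequentially. s n = f"
    if "f \<in> topspace ?K - ?S0" "range s \<subseteq> topspace ?K" "limitin ?K s f sequentially" for f s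
  proof -
    have "f \<in> char_fun ` points F" using that(1) by simp
    then obtain x where x: "x \<in> points F" "f = char_fun x" by blast
    then have "uncountable x" using that(1) by blast
    from convergent_to_uncountable_point[OF seq x(1) this that(2)] show ?thesis
      using that(3) unfolding x(2) by blast
  qed
  \<comment> \<open>In fact every dense Sigma-subset equals \<open>?S0\<close>.\<close>
  have contains: "?S0 \<subseteq> S" if S: "dense_sigma_subset ?K S" for S
  proof -
    have sS: "sigma_subset ?K S" and dS: "?K closure_of S = topspace ?K"
      using S by (auto simp: dense_sigma_subset_def)
    have "S \<subseteq> ?S0"
    proof
      fix f assume f: "f \<in> S"
      then have fK: "f \<in> topspace ?K" using sigma_subset_subset[OF sS] by blast
      \<comment> \<open>\<open>f\<close> is not isolated, because isolated points are \<open>G\<^sub>\<delta>\<close> points.\<close>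
      have "f \<in> ?K closure_of (S - {f})"
        unfolding in_closure_of
      proof (intro conjI allI impI fK, elim conjE)
        fix U assume U: "f \<in> U" "openin ?K U"
        have V: "openin ?K (U - {f})"
          using U fK Hausdorff_cantor by (intro openin_diff closedin_Hausdorff_singleton) auto
        have "U \<noteq> {f}" using nG[OF fK] open_imp_gdelta_in U(2) by auto
        then obtain g where g: "g \<in> U - {f}" using U(1) by blast
        then have "g \<in> ?K closure_of S" using openin_subset[OF U(2)] unfolding dS by blast
        then have "\<forall>T. g \<in> T \<and> openin ?K T \<longrightarrow> (\<exists>h. h \<in> S \<and> h \<in> T)"
          unfolding in_closure_of by (rule conjunct2)
        from this[rule_format, OF conjI[OF g V]] obtain h where "h \<in> S" "h \<in> U - {f}" by (elim exE conjE)
        then show "\<exists>h. h \<in> S - {f} \<and> h \<in> U" by blast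
      qed
      then obtain s where s: "range s \<subseteq> S - {f}" "limitin ?K s f sequentially"
        using sigma_subset_Frechet[OF compact sS _ f, of "S - {f}"] by blast
      show "f \<in> ?S0"
      proof (rule ccontr)
        assume "f \<notin> ?S0"
        then have "\<forall>\<^sub>F n in sequentially. s n = f"
          using limit fK s sigma_subset_subset[OF sS] by blast
        moreover have "s n \<noteq> f" for n using s(1) by auto
        ultimately show False by simp
      qed
    qed
    show ?thesis
    proof
      fix f assume f: "f \<in> ?S0"
      then have "f \<in> ?K closure_of S" unfolding dS by auto
      then obtain s where "range s \<subseteq> S" "limitin ?K s f sequentially"
        using sigma_subset_Frechet[OF compact _ \<open>S \<subseteq> ?S0\<close> f] S0 unfolding dense_sigma_subset_def by blast
      then show "f \<in> S" by (rule sigma_subset_limit[OF sS])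
    qed
  qed
  have noseq: "\<not> has_nontrivial_convergent_sequence (subtopology ?K (topspace ?K - S))"
    if S: "dense_sigma_subset ?K S" for S
  proof
    assume "has_nontrivial_convergent_sequence (subtopology ?K (topspace ?K - S))"
    then obtain s l where s: "range s \<subseteq> topspace ?K"
      "\<not> (\<exists>c. \<forall>\<^sub>F n in sequentially. s n = c)" "limitin ?K s l sequentially" "l \<in> topspace ?K - S"
      unfolding has_nontrivial_convergent_sequence_def limitin_subtopology by auto
    then show False using limit[of l s] contains[OF S] by blast
  qed
  have "points F \<noteq> {}" using empty_in_points by blast
  with nG have "weight ?K =o card_suc natLeq" by (intro weight_cantor_points)
  moreover have "Valdivia_compact ?K"
    using compact Hausdorff_cantor S0 by (auto simp: Valdivia_compact_def)
  moreover have "ccc_space ?K"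
    by (rule ccc_cantor_points[OF cl supported_UNIV[OF cl sup]])
  ultimately show ?thesis using nG noseq by blast
qed

end
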